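(* Let $R_c\in(0,\tfrac12]$ and let $f_s,f_l$ be any force coefficients satisfying the assumptions of the context and the conditions $$\int_0^{R_c}f_l(s)\,\mathrm ds\le 0\quad\text{and}\quad f_s(R_c)=0 .$$ Then there exists $\phi\in(0,\tfrac\pi2)$ such that for every angle $\vartheta\in\mathcal A$ with $\vartheta\in(0,\pi)\setminus[\phi,\pi-\phi]$, the single straight line $$\bar x_k=\frac kN\,\ell(\vartheta)\,(\cos\vartheta,\sin\vartheta),\qquad k=1,\dots,N,$$ is an unstable steady state of the particle model $\frac{\mathrm d x_j}{\mathrm d t}=\frac1N\sum_{k\ne j}\bar F(x_j-x_k)$, $j=1,\dots,N$, for $N\in\mathbb N$ sufficiently large and in the continuum limit $N\to\infty$.
   Context: Force: $f_l,f_s:[0,\infty)\to\mathbb R$ are continuously differentiable and vanish on $[R_c,\infty)$, where $R_c\in(0,\frac12]$ is the cutoff radius. $f_s$ is purely repulsive: $f_s\ge0$, $f_s(0)>0$, so $\int_0^{R_c}f_s\,\mathrm ds>0$. $f_l$ is short-range repulsive and long-range attractive (positive for small distances, negative for larger distances below the cutoff), with $f_l(R_c)=0$. Put $F(d)=(f_l(|d|)d_1,\ f_s(|d|)d_2)$ for $d=(d_1,d_2)\in[-\frac12,\frac12]^2$, and let $\bar F:\mathbb R^2\to\mathbb R^2$ be the $\mathbb Z^2$-periodic extension of $F$. A steady state is a configuration $(\bar x_j)$ with $\sum_{k\neq j}\bar F(\bar x_j-\bar x_k)=0$ for all $j$. Admissible angles (those for which the line closes up on the torus $\mathbb R^2/\mathbb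 Z^2$): $$\mathcal A=\{0,\tfrac\pi4,\tfrac\pi2,\tfrac{3\pi}4\}\cup\{\psi\in(0,\tfrac\pi4)\cup(\tfrac{3\pi}4,\pi):\cot\psi\in\mathbb Z\}\cup\{\psi\in(\tfrac\pi4,\tfrac{3\pi}4):\tan\psi\in\mathbb Z\}.$$ $\ell(\vartheta)>0$ is the length of the closed line of angle $\vartheta$ on the torus, i.e. the smallest $\ell>0$ with $\ell(\cos\vartheta,\sin\vartheta)\in\mathbb Z^2$ (so $\ell(0)=\ell(\pi/2)=1$, $\ell(\pi/4)=\ell(3\pi/4)=\sqrt2$). Stability matrix: for a steady state $(\bar x_j)_{j=1}^N$, $M_N(j,m)\in\mathbb C^{2\times2}$ is the matrix with columns $$I_i(j,m)=\frac1N\sum_{k\ne j}\Big(1-e^{2\pi i m(k-j)/N}\Big)\frac{\partial\bar F}{\partial d_i}(\bar x_j-\bar x_k),\quad i=1,2$$ (the $i$ in the exponent is the imaginary unit). It governs the linearised evolution of perturbations $\bar x_j+(\zeta_g,\zeta_h)(e^{2\pi i mj/N}+e^{-2\pi i mj/N})$. In the continuum limit, the paper takes the stability matrix $M(m)$, $m\in\mathbb N=\{1,2,\dots\}$, of the line of angle $\vartheta$ to be the matrix with columns $$I_i(m)=2\int_0^{R_c}\frac{\partial \bar F}{\partial d_i}\big((s\cos\vartheta,s\sin\vartheta)\big)\big(1-e^{-2\pi i ms}\big)\,\mathrm ds,\quad i=1,2 .$$ Instability (linear): the line is unstable in the continuum limit if $M(m)$ has an eigenvalue with positive real part for some $m\in\mathbb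 N$. It is unstable for $N$ sufficiently large if there is $N_0$ such that for every $N\ge N_0$ there are $j$ and $m\in\{1,\dots,N-1\}$ for which $M_N(j,m)$ has an eigenvalue with positive real part. *)

theory Defs
  imports "HOL-Analysis.Analysis"
begin

text \<open>
  Continuous differentiability on \<open>[0,\<infinity>)\<close>, one-sided at \<open>0\<close>. The force coefficients are total
  functions on the reals, but their values at negative arguments are never used.
\<close>

definition C1_on_nonneg :: "(real \<Rightarrow> real) \<Rightarrow> bool" where
  "C1_on_nonneg f \<longleftrightarrow>
     (\<exists>f'. continuous_on {0..} f' \<and>
           (\<forall>s\<ge>0. (f has_real_derivative f' s) (at s within {0..})))"

definition force_coefficients :: "real \<Rightarrow> (real \<Rightarrow> real) \<Rightarrow> (real \<Rightarrow> real) \<Rightarrow> bool" where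
  "force_coefficients Rc fl fs \<longleftrightarrow>
     C1_on_nonneg fl \<and> C1_on_nonneg fs \<and>
     (\<forall>s\<ge>Rc. fl s = 0) \<and> (\<forall>s\<ge>Rc. fs s = 0) \<and>
     (\<forall>s\<ge>0. fs s \<ge> 0) \<and> fs 0 > 0 \<and>
     (\<exists>a. 0 < a \<and> a < Rc \<and>
          (\<forall>s. 0 < s \<and> s < a \<longrightarrow> fl s > 0) \<and> (\<forall>s. a < s \<and> s < Rc \<longrightarrow> fl s < 0))"

definition force :: "(real \<Rightarrow> real) \<Rightarrow> (real \<Rightarrow> real) \<Rightarrow> real^2 \<Rightarrow> real^2" where
  "force fl fs d = vector [fl (norm d) * d $ 1, fs (norm d) * d $ 2]"

text \<open>
  The periodic extension evaluates the force at the representative of \<open>d\<close> modulo the integer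
  lattice in \<open>[-1/2,1/2)\<^sup>2\<close>. The choice made on the boundary of the square is immaterial: there
  \<open>norm d \<ge> 1/2 \<ge> Rc\<close>, so the force vanishes.
\<close>

definition periodic_force :: "(real \<Rightarrow> real) \<Rightarrow> (real \<Rightarrow> real) \<Rightarrow> real^2 \<Rightarrow> real^2" where
  "periodic_force fl fs d = force fl fs (\<chi> i. d $ i - of_int (round (d $ i)))"

definition partial_force :: "(real \<Rightarrow> real) \<Rightarrow> (real \<Rightarrow> real) \<Rightarrow> 2 \<Rightarrow> real^2 \<Rightarrow> real^2" where
  "partial_force fl fs i d =
     vector_derivative (\<lambda>t. periodic_force fl fs (d + t *\<^sub>R axis i 1)) (at 0)"

definition steady_state ::
    "(real \<Rightarrow> real) \<Rightarrow> (real \<Rightarrow> real) \<Rightarrow> nat \<Rightarrow> (nat \<Rightarrow> real^2) \<Rightarrow> bool" where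
  "steady_state fl fs N x \<longleftrightarrow>
     (\<forall>j\<in>{1..N}. (\<Sum>k\<in>{1..N} - {j}. periodic_force fl fs (x j - x k)) = 0)"

definition direction :: "real \<Rightarrow> real^2" where
  "direction \<theta> = vector [cos \<theta>, sin \<theta>]"

definition admissible_angles :: "real set" where
  "admissible_angles =
     {0, pi/4, pi/2, 3*pi/4} \<union>
     {\<psi> \<in> {0<..<pi/4} \<union> {3*pi/4<..<pi}. cot \<psi> \<in> \<int>} \<union>
     {\<psi> \<in> {pi/4<..<3*pi/4}. tan \<psi> \<in> \<int>}"

definition line_length :: "real \<Rightarrow> real" where
  "line_length \<theta> = (LEAST l. l > 0 \<and> (\<forall>i. (l *\<^sub>R direction \<theta>) $ i \<in> \<int>))"

definition line_config :: "real \<Rightarrow> nat \<Rightarrow> nat \<Rightarrow> real^2" where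
  "line_config \<theta> N k = (real k / real N * line_length \<theta>) *\<^sub>R direction \<theta>"

definition complex_vec :: "real^'n \<Rightarrow> complex^'n" where
  "complex_vec v = (\<chi> r. complex_of_real (v $ r))"

definition matrix_of_columns :: "('n \<Rightarrow> 'a^'m) \<Rightarrow> 'a^'n^'m" where
  "matrix_of_columns c = (\<chi> r i. c i $ r)"

definition is_eigenvalue :: "complex^'n^'n \<Rightarrow> complex \<Rightarrow> bool" where
  "is_eigenvalue A \<mu> \<longleftrightarrow> (\<exists>v. v \<noteq> 0 \<and> A *v v = \<mu> *s v)"

definition stability_matrix ::
    "(real \<Rightarrow> real) \<Rightarrow> (real \<Rightarrow> real) \<Rightarrow> nat \<Rightarrow> (nat \<Rightarrow> real^2) \<Rightarrow> nat \<Rightarrow> nat \<Rightarrow> complex^2^2" where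
  "stability_matrix fl fs N x j m = matrix_of_columns (\<lambda>i.
     (1 / of_nat N) *s
       (\<Sum>k\<in>{1..N} - {j}.
          (1 - exp (2 * of_real pi * \<i> * of_nat m * (of_nat k - of_nat j) / of_nat N)) *s
            complex_vec (partial_force fl fs i (x j - x k))))"

definition continuum_stability_matrix ::
    "real \<Rightarrow> (real \<Rightarrow> real) \<Rightarrow> (real \<Rightarrow> real) \<Rightarrow> real \<Rightarrow> nat \<Rightarrow> complex^2^2" where
  "continuum_stability_matrix Rc fl fs \<theta> m = matrix_of_columns (\<lambda>i.
     2 *s integral {0..Rc} (\<lambda>s.
       (1 - exp (- 2 * of_real pi * \<i> * of_nat m * of_real s)) *s
         complex_vec (partial_force fl fs i (s *\<^sub>R direction \<theta>))))"

definition has_unstable_eigenvalue :: "complex^2^2 \<Rightarrow> bool" where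
  "has_unstable_eigenvalue A \<longleftrightarrow> (\<exists>\<mu>. is_eigenvalue A \<mu> \<and> Re \<mu> > 0)"

definition unstable_particles ::
    "(real \<Rightarrow> real) \<Rightarrow> (real \<Rightarrow> real) \<Rightarrow> nat \<Rightarrow> (nat \<Rightarrow> real^2) \<Rightarrow> bool" where
  "unstable_particles fl fs N x \<longleftrightarrow>
     (\<exists>j\<in>{1..N}. \<exists>m\<in>{1..N - 1}. has_unstable_eigenvalue (stability_matrix fl fs N x j m))"

definition unstable_continuum ::
    "real \<Rightarrow> (real \<Rightarrow> real) \<Rightarrow> (real \<Rightarrow> real) \<Rightarrow> real \<Rightarrow> bool" where
  "unstable_continuum Rc fl fs \<theta> \<longleftrightarrow>
     (\<exists>m\<ge>1. has_unstable_eigenvalue (continuum_stability_matrix Rc fl fs \<theta> m))"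

end

theory Submission
  imports Defs
begin

text \<open>
  Both instabilities are detected by a stability matrix whose trace has positive real part, so only
  the divergence \<open>\<partial>\<^sub>1F\<^sub>1 + \<partial>\<^sub>2F\<^sub>2\<close> of the periodic force matters.

  Continuum: for \<open>\<theta> \<in> {0, \<pi>}\<close> the real part of the trace is
  \<open>2 \<integral> (1 - cos (2\<pi>ms)) (\<partial>\<^sub>1F\<^sub>1 + \<partial>\<^sub>2F\<^sub>2)(\<plusminus>s, 0) ds\<close>. Since \<open>\<integral> \<partial>\<^sub>1F\<^sub>1(\<plusminus>s, 0) ds = 0\<close> and
  \<open>\<integral> \<partial>\<^sub>2F\<^sub>2(\<plusminus>s, 0) ds = \<integral> fs > 0\<close>, it is positive for some \<open>m\<close>, and stays so for nearby angles.

  Particles: near the horizontal the closed line is \<open>t \<mapsto> t (n, 1)\<close> with \<open>n = cot \<theta>\<close> a large integer,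
  and all its windings interact. For the mode \<open>m = k \<bar>n\<bar>\<close> the limit \<open>N \<rightarrow> \<infinity>\<close> of the trace is the integral
  along the line of \<open>(1 - cos (2\<pi>kx)) (\<partial>\<^sub>1F\<^sub>1 + \<partial>\<^sub>2F\<^sub>2)(x, y)\<close>. As \<open>\<bar>n\<bar>\<close> grows the line equidistributes on
  the torus, and the integral tends to \<open>- \<integral> cos (2\<pi>kx) q(x) dx\<close> with \<open>q(x) = \<integral> \<partial>\<^sub>1F\<^sub>1(x, y) dy\<close>. Some
  cosine coefficient of \<open>q\<close> is negative: \<open>q\<close> has mean zero and \<open>q(0) = 2 \<integral> fl \<le> 0\<close>, so if all were
  nonnegative, then \<open>q(x) + q(-x) \<le> 2 q(0) \<le> 0\<close> and the even part of \<open>q\<close> would vanish, contradicting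
  the attraction of \<open>fl\<close> near the cutoff.
\<close>

section \<open>Cosine integrals of periodic functions\<close>

text \<open>For an antiderivative \<open>P\<close> the integral over the shifted period is
  \<open>P (1 + r) - P r\<close>. Its derivative in \<open>r\<close> is
  \<open>g (r + 1) - g r = 0\<close>, so it does not depend on \<open>r\<close>.\<close>

lemma integral_periodic_shift:
  fixes g :: "real \<Rightarrow> real"
  assumes cont: "continuous_on UNIV g" and per: "\<And>x. g (x + 1) = g x"
  shows "integral {0..1} (\<lambda>t. g (t + s)) = integral {0..1} g"
proof -
  \<comment> \<open>The interval \<open>{a..b}\<close> contains every \<open>x + r\<close> with
    \<open>x \<in> {0..1}\<close> and \<open>\<bar>r\<bar> \<le> \<bar>s\<bar>\<close> in its
    interior, so that \<open>P\<close> has two-sided derivatives there.\<close>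
  define a where "a = - \<bar>s\<bar> - 1"
  define b where "b = \<bar>s\<bar> + 2"
  obtain P where P: "\<And>x. x \<in> {a..b} \<Longrightarrow> (P has_vector_derivative g x) (at x within {a..b})"
    using antiderivative_continuous[of a b g] cont continuous_on_subset by blast
  have P': "(P has_real_derivative g x) (at x)" if "a < x" "x < b" for x
    using P[of x] that
    by (simp add: has_real_derivative_iff_has_vector_derivative at_within_Icc_at)
  have ftc: "integral {0..1} (\<lambda>t. g (t + r)) = P (1 + r) - P r" if "\<bar>r\<bar> \<le> \<bar>s\<bar>" for r
  proof -
    have "((\<lambda>t. g (t + r)) has_integral (P (1 + r) - P (0 + r))) {0..1}"
    proof (rule fundamental_theorem_of_calculus)
      fix x :: real assume "x \<in> {0..1}"
      then have "(P has_real_derivative g (x + r)) (at (x + r))"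
        using that by (intro P') (auto simp: a_def b_def)
      then have "((\<lambda>t. P (t + r)) has_real_derivative g (x + r)) (at x)"
        by (simp add: DERIV_shift)
      then show "((\<lambda>t. P (t + r)) has_vector_derivative g (x + r)) (at x within {0..1})"
        by (simp add: has_real_derivative_iff_has_vector_derivative has_vector_derivative_at_within)
    qed auto
    then show ?thesis by (simp add: integral_unique)
  qed
  have "\<exists>c. \<forall>r\<in>{-\<bar>s\<bar>..\<bar>s\<bar>}. P (1 + r) - P r = c"
  proof (rule has_derivative_zero_constant)
    fix r assume r: "r \<in> {-\<bar>s\<bar>..\<bar>s\<bar>}"
    have "(P has_real_derivative g (r + 1)) (at (r + 1))"
      using r by (intro P') (auto simp: a_def b_def)
    then have "((\<lambda>r. P (1 + r)) has_real_derivative g (r + 1)) (at r)"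
      by (simp add: DERIV_shift add.commute[of 1])
    moreover have "(P has_real_derivative g r) (at r)"
      using r by (intro P') (auto simp: a_def b_def)
    ultimately have "((\<lambda>r. P (1 + r) - P r) has_real_derivative g (r + 1) - g r) (at r)"
      by (rule DERIV_diff)
    then have "((\<lambda>r. P (1 + r) - P r) has_real_derivative 0) (at r)"
      by (simp add: per)
    then show "((\<lambda>r. P (1 + r) - P r) has_derivative (\<lambda>h. 0)) (at r within {-\<bar>s\<bar>..\<bar>s\<bar>})"
      by (simp add: has_field_derivative_def lambda_zero has_derivative_at_withinI)
  qed auto
  then obtain c where c: "\<And>r. r \<in> {-\<bar>s\<bar>..\<bar>s\<bar>} \<Longrightarrow> P (1 + r) - P r = c" by blast
  have "P (1 + s) - P s = P (1 + 0) - P 0"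
    using c[of s] c[of 0] by (cases "s \<ge> 0") auto
  then show ?thesis
    using ftc[of s] ftc[of 0] by simp
qed

lemma integral_symmetric_period:
  fixes g :: "real \<Rightarrow> real"
  assumes "continuous_on UNIV g" and "\<And>x. g (x + 1) = g x"
  shows "integral {-1/2..1/2} g = integral {0..1} g"
proof -
  have "integral {-1/2..1/2} g = integral {0..1} (\<lambda>t. g (t + - (1/2)))"
    using integral_shift_real_ivl[of "-1/2" "-1/2" "1/2" g] by simp
  also have "\<dots> = integral {0..1} g"
    by (rule integral_periodic_shift) fact+
  finally show ?thesis .
qed

text \<open>Since \<open>K cos (a x) = cos (a x) / 2 + cos ((a + 1) x) / 4 + cos ((a - 1) x) / 4\<close> for
  \<open>K = (1 + cos x) / 2\<close>, the powers of \<open>K\<close> are convex combinations of cosines.\<close>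
lemma integral_cos_kernel_ge:
  fixes g :: "real \<Rightarrow> real" and a :: int
  assumes cont: "continuous_on {b..c} g"
    and ge: "\<And>a::int. L \<le> integral {b..c} (\<lambda>u. cos (2 * pi * of_int a * u) * g u)"
  shows "L \<le> integral {b..c} (\<lambda>u. ((1 + cos (2 * pi * u)) / 2) ^ N * cos (2 * pi * of_int a * u) * g u)"
proof (induction N arbitrary: a)
  case 0
  then show ?case using ge[of a] by simp
next
  case (Suc N)
  let ?F = "\<lambda>a::int. \<lambda>u. ((1 + cos (2 * pi * u)) / 2) ^ N * cos (2 * pi * of_int a * u) * g u"
  have int: "?F a integrable_on {b..c}" for a
    by (intro integrable_continuous_real continuous_intros cont) auto
  have "((1 + cos (2 * pi * u)) / 2) ^ Suc N * cos (2 * pi * of_int a * u) * g u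
      = 1/2 * ?F a u + 1/4 * ?F (a + 1) u + 1/4 * ?F (a - 1) u" for u
  proof -
    have 1: "2 * pi * of_int (a + 1) * u = 2 * pi * of_int a * u + 2 * pi * u"
      and 2: "2 * pi * of_int (a - 1) * u = 2 * pi * of_int a * u - 2 * pi * u"
      by (simp_all add: algebra_simps)
    show ?thesis unfolding 1 2 cos_add cos_diff by (simp add: field_simps)
  qed
  then have "integral {b..c} (\<lambda>u. ((1 + cos (2 * pi * u)) / 2) ^ Suc N * cos (2 * pi * of_int a * u) * g u)
      = integral {b..c} (\<lambda>u. 1/2 * ?F a u + 1/4 * ?F (a + 1) u + 1/4 * ?F (a - 1) u)"
    by presburger
  also have "\<dots> = 1/2 * integral {b..c} (?F a) + 1/4 * integral {b..c} (?F (a + 1))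
      + 1/4 * integral {b..c} (?F (a - 1))"
    by (intro integral_unique has_integral_add has_integral_mult_right integrable_integral int)
  finally show ?case
    using Suc.IH[of a] Suc.IH[of "a + 1"] Suc.IH[of "a - 1"] by linarith
qed

lemma cos_kernel_bounds:
  fixes x :: real
  shows "0 \<le> (1 + cos x) / 2" "(1 + cos x) / 2 \<le> 1"
  using cos_ge_minus_one[of x] cos_le_one[of x] by (simp_all del: cos_ge_minus_one)

text \<open>Otherwise every cosine integral is at least the positive number
  \<open>integral {0..R} w\<close>, hence so is every integral against a power of the kernel
  \<open>(1 + cos (2 * pi * s)) / 2\<close>. As \<open>R \<le> 1/2\<close>, this kernel is below 1
  on \<open>{0..R}\<close> except at 0, so those integrals tend to 0.\<close>

lemma exists_cos_integral_less:
  fixes w :: "real \<Rightarrow> real"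
  assumes cont: "continuous_on {0..R} w" and R: "R \<le> 1/2"
    and pos: "0 < integral {0..R} w"
  obtains m :: nat where "m \<ge> 1"
    and "integral {0..R} (\<lambda>s. cos (2 * pi * real m * s) * w s) < integral {0..R} w"
proof -
  have "\<exists>m\<ge>1. integral {0..R} (\<lambda>s. cos (2 * pi * real m * s) * w s) < integral {0..R} w"
  proof (rule ccontr)
    assume "\<not> ?thesis"
    then have *: "integral {0..R} w \<le> integral {0..R} (\<lambda>s. cos (2 * pi * real m * s) * w s)"
      if "m \<ge> 1" for m :: nat
      using that by force
    \<comment> \<open>The recursion for kernel powers moves the frequency by one in both directions,
      so the bound is needed for all integers: evenness of cosine covers negative frequencies, and 0
      is trivial.\<close>
    have ge: "integral {0..R} w \<le> integral {0..R} (\<lambda>s. cos (2 * pi * of_int a * s) * w s)" for a :: int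
    proof (cases "a = 0")
      case False
      have "cos (2 * pi * of_int a * s) = cos (2 * pi * real (nat \<bar>a\<bar>) * s)" for s
        by (cases "a \<ge> 0") auto
      then show ?thesis using *[of "nat \<bar>a\<bar>"] False by simp
    qed simp
    let ?f = "\<lambda>N s. ((1 + cos (2 * pi * s)) / 2) ^ N * w s"
    have lim: "(\<lambda>N. integral {0..R} (?f N)) \<longlonglongrightarrow> integral {0..R} (\<lambda>s. if s = 0 then w 0 else 0)"
    proof (rule dominated_convergence)
      show "?f N integrable_on {0..R}" for N
        by (intro integrable_continuous_real continuous_intros cont) auto
      show "(\<lambda>s. \<bar>w s\<bar>) integrable_on {0..R}"
        by (intro integrable_continuous_real continuous_intros cont)
      show "norm (?f N s) \<le> \<bar>w s\<bar>" for N s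
        using mult_right_mono[OF power_le_one[OF cos_kernel_bounds, of "2 * pi * s" N], of "\<bar>w s\<bar>"]
          cos_kernel_bounds[of "2 * pi * s"]
        by (simp add: abs_mult)
      show "(\<lambda>N. ?f N s) \<longlonglongrightarrow> (if s = 0 then w 0 else 0)" if s: "s \<in> {0..R}" for s
      proof (cases "s = 0")
        case False
        then have "cos (2 * pi * s) < cos 0"
          using s R by (intro cos_monotone_0_pi) (auto simp: mult_le_cancel_left1)
        then have "(\<lambda>N. ((1 + cos (2 * pi * s)) / 2) ^ N) \<longlonglongrightarrow> 0"
          using cos_kernel_bounds[of "2 * pi * s"] by (intro LIMSEQ_realpow_zero) auto
        then show ?thesis using False by (auto intro: tendsto_mult_left_zero)
      qed simp
    qed
    have "integral {0..R} (\<lambda>s. if s = 0 then w 0 else 0) = integral {0..R} (\<lambda>s. 0)"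
      by (rule integral_spike[of "{0}"]) auto
    then have "(\<lambda>N. integral {0..R} (?f N)) \<longlonglongrightarrow> 0" using lim by simp
    moreover have "integral {0..R} w \<le> integral {0..R} (?f N)" for N
      using integral_cos_kernel_ge[OF cont ge, of N 0] by simp
    ultimately have "integral {0..R} w \<le> 0" by (intro LIMSEQ_le_const) auto
    then show False using pos by simp
  qed
  then show ?thesis using that by blast
qed

text \<open>Powers of a kernel peaked at 0 concentrate the integral near 0. If \<open>g 0\<close>
  were negative, these integrals would become negative, although they are convex combinations of the
  given nonnegative ones.\<close>

lemma nonneg_at_0_if_cos_integrals_nonneg:
  fixes g :: "real \<Rightarrow> real"
  assumes cont: "continuous_on {-1/2..1/2} g"
    and nn: "\<And>a::int. 0 \<le> integral {-1/2..1/2} (\<lambda>u. cos (2 * pi * of_int a * u) * g u)"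
  shows "0 \<le> g 0"
proof (rule ccontr)
  assume neg: "\<not> 0 \<le> g 0"
  define e where "e = - g 0 / 2"
  have "e > 0" using neg by (simp add: e_def)
  obtain d0 where d0: "d0 > 0" "\<And>u. u \<in> {-1/2..1/2} \<Longrightarrow> \<bar>u\<bar> < d0 \<Longrightarrow> \<bar>g u - g 0\<bar> < e"
    using cont[unfolded continuous_on_iff dist_real_def, rule_format, of 0 e] \<open>e > 0\<close> by auto
  define d where "d = min (d0 / 2) (1/4)"
  have d: "0 < d" "d < d0" "d \<le> 1/4" using d0 by (auto simp: d_def)
  have near: "g u \<le> - e" if "\<bar>u\<bar> \<le> d" for u
  proof -
    have "\<bar>g u - g 0\<bar> < - g 0 / 2"
      using d0(2)[of u] that d unfolding e_def atLeastAtMost_iff by linarith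
    then show ?thesis unfolding e_def by linarith
  qed
  \<comment> \<open>Dividing the kernel by its value \<open>r\<close> at distance \<open>d\<close>
    makes it at least 1 for \<open>\<bar>u\<bar> \<le> d\<close> and below 1 farther out;
    \<open>d \<le> 1/4\<close> keeps \<open>r\<close> positive.\<close>
  define r where "r = (1 + cos (2 * pi * d)) / 2"
  have "2 * pi * d < pi" using d pi_gt_zero by (auto simp: algebra_simps intro: order.strict_trans1)
  then have "cos pi < cos (2 * pi * d)"
    using d by (intro cos_monotone_0_pi) auto
  then have r: "r > 0" by (simp add: r_def)
  let ?k = "\<lambda>u. (1 + cos (2 * pi * u)) / 2 / r"
  have k0: "0 \<le> ?k u" for u using cos_kernel_bounds[of "2 * pi * u"] r by simp
  have cosabs: "cos (2 * pi * u) = cos (2 * pi * \<bar>u\<bar>)" for u by (cases "u \<ge> 0") auto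
  have k_near: "1 \<le> ?k u" if "\<bar>u\<bar> \<le> d" for u
  proof -
    have "cos (2 * pi * d) \<le> cos (2 * pi * \<bar>u\<bar>)"
      using that \<open>2 * pi * d < pi\<close> by (intro cos_monotone_0_pi_le) auto
    then show ?thesis using r cosabs[of u] by (simp add: r_def)
  qed
  have k_far: "?k u < 1" if "d < \<bar>u\<bar>" "\<bar>u\<bar> \<le> 1/2" for u
  proof -
    have "cos (2 * pi * \<bar>u\<bar>) < cos (2 * pi * d)"
      using that d by (intro cos_monotone_0_pi) (auto simp: mult_le_cancel_left1)
    then show ?thesis using r cosabs[of u] by (simp add: r_def)
  qed
  obtain B where B: "\<And>u. u \<in> {-1/2..1/2} \<Longrightarrow> \<bar>g u\<bar> \<le> B"
    using compact_imp_bounded[OF compact_continuous_image[OF cont compact_Icc]]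
    unfolding bounded_iff real_norm_def by blast
  let ?f = "\<lambda>N u. ?k u ^ N * g u"
  \<comment> \<open>Near 0 the powers of the normalised kernel are unbounded in \<open>N\<close>.
    There \<open>?f N u\<close> is replaced by its upper bound \<open>- e\<close>, which makes
    dominated convergence applicable.\<close>
  let ?h = "\<lambda>N u. if \<bar>u\<bar> \<le> d then - e else ?f N u"
  have ifint: "(\<lambda>u. if \<bar>u\<bar> \<le> d then x else F u) integrable_on {-1/2..1/2}"
    if F: "continuous_on {-1/2..1/2} F" for x and F :: "real \<Rightarrow> real"
  proof -
    \<comment> \<open>The case distinction may jump at \<open>\<bar>u\<bar> = d\<close>, so it is
      split into a continuous function and one supported on \<open>{-d..d}\<close>.\<close>
    have "(\<lambda>u. F u + (if u \<in> {-d..d} then x - F u else 0)) integrable_on {-1/2..1/2}"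
    proof (intro integrable_add)
      show "F integrable_on {-1/2..1/2}" by (intro integrable_continuous_real F)
      have "(\<lambda>u. x - F u) integrable_on {-d..d}"
        by (intro integrable_continuous_real continuous_intros continuous_on_subset[OF F]) (use d in auto)
      then show "(\<lambda>u. if u \<in> {-d..d} then x - F u else 0) integrable_on {-1/2..1/2}"
        by (subst integrable_restrict_Int) (use d in \<open>simp add: Int_absorb2 inf.absorb1\<close>)
    qed
    then show ?thesis by (rule integrable_eq) auto
  qed
  have contf: "continuous_on {-1/2..1/2} (?f N)" for N
    using r by (intro continuous_intros cont) auto
  have lim: "(\<lambda>N. integral {-1/2..1/2} (?h N)) \<longlonglongrightarrow> integral {-1/2..1/2} (\<lambda>u. if \<bar>u\<bar> \<le> d then - e else 0)"
  proof (rule dominated_convergence)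
    show "?h N integrable_on {-1/2..1/2}" for N by (intro ifint contf)
    show "(\<lambda>u::real. max e B) integrable_on {-1/2..1/2}" by (rule integrable_const_ivl)
    show "norm (?h N u) \<le> max e B" if "u \<in> {-1/2..1/2}" for N u
    proof (cases "\<bar>u\<bar> \<le> d")
      case False
      have "\<bar>u\<bar> \<le> 1/2" using that by (auto simp: abs_le_iff)
      then have "?k u \<le> 1" using k_far[of u] False by linarith
      then have "?k u ^ N * \<bar>g u\<bar> \<le> 1 * B"
        using B[OF that] k0[of u] by (intro mult_mono power_le_one) auto
      then show ?thesis using False k0[of u] by (simp add: abs_mult)
    qed (use \<open>e > 0\<close> in auto)
    show "(\<lambda>N. ?h N u) \<longlonglongrightarrow> (if \<bar>u\<bar> \<le> d then - e else 0)" if "u \<in> {-1/2..1/2}" for u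
    proof (cases "\<bar>u\<bar> \<le> d")
      case False
      have "\<bar>u\<bar> \<le> 1/2" using that by (auto simp: abs_le_iff)
      then have "?k u < 1" using k_far[of u] False by linarith
      then have "(\<lambda>N. ?k u ^ N) \<longlonglongrightarrow> 0"
        using k0[of u] by (intro LIMSEQ_realpow_zero)
      then show ?thesis using False by (auto intro: tendsto_mult_left_zero)
    qed simp
  qed
  have "0 \<le> integral {-1/2..1/2} (?h N)" for N
  proof -
    have "0 \<le> integral {-1/2..1/2} (\<lambda>u. ((1 + cos (2 * pi * u)) / 2) ^ N * g u)"
      using integral_cos_kernel_ge[OF cont nn, of N 0] by simp
    then have "0 \<le> inverse r ^ N * integral {-1/2..1/2} (\<lambda>u. ((1 + cos (2 * pi * u)) / 2) ^ N * g u)"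
      using r by simp
    also have "\<dots> = integral {-1/2..1/2} (?f N)"
      by (subst integral_mult_right [symmetric]) (simp add: power_divide power_inverse field_simps)
    also have "\<dots> \<le> integral {-1/2..1/2} (?h N)"
    proof (rule integral_le)
      fix u :: real assume "u \<in> {-1/2..1/2}"
      show "?f N u \<le> ?h N u"
      proof (cases "\<bar>u\<bar> \<le> d")
        case True
        have "?k u ^ N * g u \<le> 1 * g u"
          using one_le_power[OF k_near[OF True], of N] near[OF True] \<open>e > 0\<close>
          by (intro mult_right_mono_neg) auto
        then show ?thesis using True near[OF True] by simp
      qed simp
    qed (intro integrable_continuous_real contf ifint)+
    finally show ?thesis .
  qed
  then have "0 \<le> integral {-1/2..1/2} (\<lambda>u. if \<bar>u\<bar> \<le> d then - e else 0)"
    by (intro LIMSEQ_le_const[OF lim]) auto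
  also have "\<dots> = integral {-1/2..1/2} (\<lambda>u. if u \<in> {-d..d} then - e else 0)"
    by (rule integral_cong) auto
  also have "\<dots> = integral {-d..d} (\<lambda>u. - e)"
    by (subst integral_restrict_Int) (use d in \<open>simp add: Int_absorb2 inf.absorb1\<close>)
  also have "\<dots> < 0" using d \<open>e > 0\<close> by simp
  finally show False by simp
qed

lemma periodic_add_of_int:
  fixes g :: "real \<Rightarrow> 'a"
  assumes "\<And>x. g (x + 1) = g x"
  shows "g (x + of_int k) = g x"
proof (induction k rule: int_induct[where k = 0])
  case (step1 i)
  then show ?case using assms[of "x + of_int i"] by (simp add: add.assoc)
next
  case (step2 i)
  then show ?case using assms[of "x + of_int (i - 1)"] by simp
qed simp

text \<open>If all coefficients \<open>c a\<close> are nonnegative, then so are those of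
  \<open>q u - (q (u + x) + q (u - x)) / 2\<close>, namely
  \<open>(1 - cos (2 * pi * a * x)) * c a\<close>. Nonnegativity of this function at 0 gives
  \<open>q x + q (- x) \<le> 2 * q 0 \<le> 0\<close>; having mean zero, the even part of
  \<open>q\<close> vanishes, against \<open>nz\<close>.\<close>

lemma exists_negative_cos_integral:
  fixes q :: "real \<Rightarrow> real"
  assumes cont: "continuous_on UNIV q" and per: "\<And>x. q (x + 1) = q x"
    and mean: "integral {0..1} q = 0" and q0: "q 0 \<le> 0"
    and nz: "q x0 + q (- x0) \<noteq> 0"
  obtains a :: nat where "a \<ge> 1" and "integral {0..1} (\<lambda>u. cos (2 * pi * real a * u) * q u) < 0"
proof -
  have "\<exists>a\<ge>1. integral {0..1} (\<lambda>u. cos (2 * pi * real a * u) * q u) < 0"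
  proof (rule ccontr)
    assume contr: "\<not> ?thesis"
    define c where "c = (\<lambda>a::int. integral {0..1} (\<lambda>u. cos (2 * pi * of_int a * u) * q u))"
    have cn: "0 \<le> c a" for a
    proof (cases "a = 0")
      case True
      then show ?thesis using mean by (simp add: c_def)
    next
      case False
      have "cos (2 * pi * of_int a * s) = cos (2 * pi * real (nat \<bar>a\<bar>) * s)" for s
        by (cases "a \<ge> 0") auto
      then have "c a = integral {0..1} (\<lambda>u. cos (2 * pi * real (nat \<bar>a\<bar>) * u) * q u)"
        by (simp add: c_def)
      moreover have "nat \<bar>a\<bar> \<ge> 1" using False by simp
      ultimately show ?thesis using contr by force
    qed
    have cos_per: "cos (2 * pi * of_int a * (u + 1)) = cos (2 * pi * of_int a * u)" for a :: int and u :: real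
    proof -
      have "2 * pi * of_int a * (u + 1) = 2 * pi * of_int a * u + 2 * pi * of_int a"
        by (simp add: algebra_simps)
      then show ?thesis
        by (simp add: cos_add)
    qed
    note cq = continuous_on_subset[OF cont] continuous_on_compose2[OF cont]
    have le: "q x + q (- x) \<le> 2 * q 0" for x
    proof -
      let ?g = "\<lambda>u. q u - (q (u + x) + q (u + - x)) / 2"
      have "0 \<le> ?g 0"
      proof (rule nonneg_at_0_if_cos_integrals_nonneg)
        show "continuous_on {-1/2..1/2} ?g"
          by (intro continuous_intros cq) auto
        fix a :: int
        let ?C = "\<lambda>u. cos (2 * pi * of_int a * u)"
        let ?S = "\<lambda>u. sin (2 * pi * of_int a * u)"
        have per1: "q (u + 1 + y) = q (u + y)" for u y
          using per[of "u + y"] by (simp add: add_ac)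
        have *: "integral {0..1} (\<lambda>u. ?C u * q (u + y)) = integral {0..1} (\<lambda>u. ?C (u - y) * q u)" for y
        proof -
          have "integral {0..1} (\<lambda>u. ?C (u - y) * q u) = integral {0..1} (\<lambda>u. ?C (u + y - y) * q (u + y))"
          proof (rule integral_periodic_shift[symmetric])
            show "continuous_on UNIV (\<lambda>u. ?C (u - y) * q u)" by (intro continuous_intros cont)
            show "?C (u + 1 - y) * q (u + 1) = ?C (u - y) * q u" for u
              using cos_per[of a "u - y"] per[of u] by (simp add: algebra_simps)
          qed
          then show ?thesis by simp
        qed
        have int: "(\<lambda>u. ?C u * q (u + y)) integrable_on {0..1}" for y
          by (intro integrable_continuous_real continuous_intros cq) auto
        have int2: "(\<lambda>u. ?C (u - y) * q u) integrable_on {0..1}" for y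
          by (intro integrable_continuous_real continuous_intros cq) auto
        have "integral {-1/2..1/2} (\<lambda>u. ?C u * ?g u) = integral {0..1} (\<lambda>u. ?C u * ?g u)"
        proof (rule integral_symmetric_period)
          show "continuous_on UNIV (\<lambda>u. ?C u * ?g u)" by (intro continuous_intros cq) auto
          show "?C (u + 1) * ?g (u + 1) = ?C u * ?g u" for u
            by (simp only: cos_per per per1)
        qed
        also have "\<dots> = integral {0..1} (\<lambda>u. ?C u * q (u + 0) - (?C u * q (u + x) + ?C u * q (u + - x)) / 2)"
          by (intro integral_cong) (simp add: algebra_simps add_divide_distrib)
        also have "\<dots> = integral {0..1} (\<lambda>u. ?C u * q (u + 0))
            - (integral {0..1} (\<lambda>u. ?C u * q (u + x)) + integral {0..1} (\<lambda>u. ?C u * q (u + - x))) / 2"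
          by (intro integral_unique has_integral_diff has_integral_divide has_integral_add integrable_integral int)
        also have "integral {0..1} (\<lambda>u. ?C u * q (u + x)) + integral {0..1} (\<lambda>u. ?C u * q (u + - x))
            = integral {0..1} (\<lambda>u. ?C (u - x) * q u + ?C (u - - x) * q u)"
          unfolding * by (rule integral_add[symmetric]) (rule int2)+
        also have "\<dots> = integral {0..1} (\<lambda>u. 2 * cos (2 * pi * of_int a * x) * (?C u * q u))"
        proof (intro integral_cong)
          fix u :: real
          have e: "2 * pi * of_int a * (u - x) = 2 * pi * of_int a * u - 2 * pi * of_int a * x"
            "2 * pi * of_int a * (u - - x) = 2 * pi * of_int a * u + 2 * pi * of_int a * x"
            by (simp_all add: algebra_simps)
          show "?C (u - x) * q u + ?C (u - - x) * q u = 2 * cos (2 * pi * of_int a * x) * (?C u * q u)"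
            unfolding e cos_add cos_diff by (simp add: algebra_simps)
        qed
        also have "\<dots> = 2 * cos (2 * pi * of_int a * x) * c a"
          unfolding c_def by (rule integral_mult_right)
        finally have "integral {-1/2..1/2} (\<lambda>u. ?C u * ?g u) = (1 - cos (2 * pi * of_int a * x)) * c a"
          by (simp add: c_def algebra_simps)
        then show "0 \<le> integral {-1/2..1/2} (\<lambda>u. ?C u * ?g u)"
          using cn[of a] cos_le_one[of "2 * pi * of_int a * x"] by (simp del: cos_le_one)
      qed
      then show ?thesis by simp
    qed
    let ?h = "\<lambda>x. - (q x + q (- x))"
    have h0: "?h x \<ge> 0" for x using le[of x] q0 by simp
    have conth: "continuous_on S ?h" for S by (intro continuous_intros cq) auto
    \<comment> \<open>The even part is shown to vanish on one period only, so \<open>x0\<close> is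
      translated into it.\<close>
    have "\<exists>n::int. x0 + of_int n \<in> {-1/2..1/2}"
    proof
      show "x0 + of_int (- round x0) \<in> {-1/2..1/2}"
        using of_int_round_ge[of x0] of_int_round_le[of x0] by simp
    qed
    then obtain n where n: "x0 + of_int n \<in> {-1/2..1/2}" by blast
    have "integral {-1/2..1/2} q = 0"
      using integral_symmetric_period[OF cont per] mean by simp
    moreover have "integral {-1/2..1/2} (\<lambda>x. q (- x)) = integral {-1/2..1/2} q"
      using Henstock_Kurzweil_Integration.integral_reflect_real[of "1/2" "-1/2" q] by simp
    ultimately have "integral {-1/2..1/2} ?h = 0"
      by (subst integral_neg, subst integral_add)
        (auto intro!: integrable_continuous_real cq continuous_intros)
    then have "\<forall>x\<in>{-1/2..1/2}. ?h x = 0"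
      by (subst integral_eq_0_iff[symmetric]) (use h0 conth in simp_all)
    from bspec[OF this n] have "q (x0 + of_int n) + q (- (x0 + of_int n)) = 0" by linarith
    moreover have "q (- (x0 + of_int n)) = q (- x0)"
      using periodic_add_of_int[of q "- x0" "- n", OF per] by simp
    moreover have "q (x0 + of_int n) = q x0" by (rule periodic_add_of_int) (rule per)
    ultimately show False using nz by simp
  qed
  then show ?thesis using that by blast
qed

section \<open>Equidistribution and Riemann sums\<close>

text \<open>By periodicity the integral along the line equals \<open>\<integral> G (n t + x) (t + x / n) dt\<close> for every \<open>x\<close>;
  averaging over \<open>x\<close> leaves an error of one step \<open>x / n\<close> in the second argument.\<close>
lemma torus_line_equidistribution:
  fixes G :: "real \<Rightarrow> real \<Rightarrow> real"
  assumes cont: "continuous_on UNIV (\<lambda>(x, y). G x y)"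
    and per1: "\<And>x y. G (x + 1) y = G x y" and per2: "\<And>x y. G x (y + 1) = G x y"
    and "e > 0"
  shows "\<exists>n0>0. \<forall>n::int. n0 \<le> \<bar>real_of_int n\<bar> \<longrightarrow>
    \<bar>integral {0..1} (\<lambda>t. G (of_int n * t) t) - integral {0..1} (\<lambda>x. integral {0..1} (G x))\<bar> \<le> e"
proof -
  have cG: "continuous_on S (\<lambda>z. G (f z) (g z))"
    if "continuous_on S f" "continuous_on S g" for S :: "'z::topological_space set" and f g
    using continuous_on_compose2[OF cont continuous_on_Pair[OF that]] by auto
  \<comment> \<open>The window \<open>{-1..2}\<close> in the second variable leaves room for
    \<open>t + h\<close> with \<open>\<bar>h\<bar> \<le> 1\<close>; the first variable is reduced to
    \<open>{0..1}\<close> by \<open>frac\<close>.\<close>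
  have "uniformly_continuous_on ({0..1} \<times> {-1..2}) (\<lambda>(x, y). G x y)"
    by (intro compact_uniformly_continuous continuous_on_subset[OF cont] compact_Times) auto
  then obtain d where d: "d > 0"
    "\<And>p p'. p \<in> {0..1} \<times> {-1..2} \<Longrightarrow> p' \<in> {0..1} \<times> {-1..2} \<Longrightarrow> dist p' p < d \<Longrightarrow>
      dist (case p' of (x, y) \<Rightarrow> G x y) (case p of (x, y) \<Rightarrow> G x y) < e"
    using \<open>e > 0\<close> unfolding uniformly_continuous_on_def by metis
  have step: "\<bar>G u (t + h) - G u t\<bar> \<le> e" if "t \<in> {0..1}" "\<bar>h\<bar> < d" "\<bar>h\<bar> \<le> 1" for u t h
  proof -
    have *: "G u y = G (frac u) y" for y
      using periodic_add_of_int[of "\<lambda>x. G x y" "frac u" "\<lfloor>u\<rfloor>"] per1 by (simp add: frac_def)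
    have "frac u \<in> {0..1}" using frac_ge_0[of u] frac_lt_1[of u] by simp
    then show ?thesis
      using d(2)[of "(frac u, t)" "(frac u, t + h)"] that
      by (force simp: dist_Pair_Pair dist_real_def *[symmetric])
  qed
  \<comment> \<open>With this threshold the displacement \<open>x / n\<close> for
    \<open>x \<in> {0..1}\<close> is at most 1 and below \<open>d\<close> in absolute value.\<close>
  define n0 where "n0 = max 1 (2 / d)"
  have main: "\<bar>integral {0..1} (\<lambda>t. G (of_int n * t) t) - integral {0..1} (\<lambda>x. integral {0..1} (G x))\<bar> \<le> e"
    if n: "n0 \<le> \<bar>of_int n\<bar>" for n :: int
  proof -
    have n1: "\<bar>of_int n\<bar> \<ge> (1::real)" and n2: "2 / d \<le> \<bar>of_int n\<bar>" using n by (auto simp: n0_def)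
    then have nz: "(of_int n :: real) \<noteq> 0" by auto
    let ?I = "integral {0..1} (\<lambda>t. G (of_int n * t) t)"
    let ?J = "\<lambda>x. integral {0..1} (\<lambda>t. G (of_int n * t + x) t)"
    have shift: "integral {0..1} (\<lambda>t. G (of_int n * t + x) (t + x / of_int n)) = ?I" for x
    proof -
      have "integral {0..1} (\<lambda>t. G (of_int n * (t + x / of_int n)) (t + x / of_int n)) = ?I"
      proof (rule integral_periodic_shift)
        show "continuous_on UNIV (\<lambda>t. G (of_int n * t) t)" by (intro cG continuous_intros)
        show "G (of_int n * (t + 1)) (t + 1) = G (of_int n * t) t" for t
          using periodic_add_of_int[of "\<lambda>x. G x t" "of_int n * t" n] per1 per2
          by (simp add: distrib_left)
      qed
      then show ?thesis using nz by (simp add: distrib_left)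
    qed
    have contJ: "continuous_on {0..1} ?J"
      using integral_continuous_on_param[of "{0..1}" 0 1 "\<lambda>x t. G (of_int n * t + x) t"]
      by (simp add: split_beta cG continuous_intros)
    have bound: "\<bar>?I - ?J x\<bar> \<le> e" if x: "x \<in> {0..1}" for x
    proof -
      have "\<bar>x / of_int n\<bar> \<le> 1 / \<bar>of_int n\<bar>" using x by (simp add: divide_right_mono)
      moreover have "1 / \<bar>of_int n\<bar> \<le> (1::real)" using n1 by simp
      moreover have "1 / \<bar>of_int n\<bar> < d" 
      proof -
        have "2 \<le> d * \<bar>of_int n\<bar>" using n2 d by (simp add: field_simps)
        then show ?thesis using n1 by (simp add: field_simps)
      qed
      ultimately have h: "\<bar>x / of_int n\<bar> < d" "\<bar>x / of_int n\<bar> \<le> 1" by linarith+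
      have "?I - ?J x = integral {0..1} (\<lambda>t. G (of_int n * t + x) (t + x / of_int n) - G (of_int n * t + x) t)"
        unfolding shift[of x, symmetric]
        by (rule integral_diff[symmetric])
          (use nz in \<open>intro integrable_continuous_real cG continuous_intros; simp\<close>)+
      also have "norm \<dots> \<le> e * (1 - 0)"
      proof (rule integral_bound)
        show "continuous_on {0..1} (\<lambda>t. G (of_int n * t + x) (t + x / of_int n) - G (of_int n * t + x) t)"
          using nz by (intro cG continuous_intros) auto
      qed (use step h in auto)
      finally show ?thesis by simp
    qed
    \<comment> \<open>After exchanging the integrals, the shift by \<open>n * t\<close> acts on a
      full period in \<open>x\<close> and disappears.\<close>
    have "integral {0..1} ?J = integral {0..1} (\<lambda>t. integral {0..1} (\<lambda>x. G (of_int n * t + x) t))"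
      using integral_swap_continuous[of 0 0 1 1 "\<lambda>x t. G (of_int n * t + x) t"]
      by (simp add: split_beta cG continuous_intros)
    also have "\<dots> = integral {0..1} (\<lambda>t. integral {0..1} (\<lambda>x. G x t))"
    proof (rule integral_cong)
      fix t
      show "integral {0..1} (\<lambda>x. G (of_int n * t + x) t) = integral {0..1} (\<lambda>x. G x t)"
        using integral_periodic_shift[of "\<lambda>x. G x t" "of_int n * t"] per1
        by (simp add: add.commute cG continuous_intros)
    qed
    also have "\<dots> = integral {0..1} (\<lambda>x. integral {0..1} (G x))"
      using integral_swap_continuous[of 0 0 1 1 G] continuous_on_subset[OF cont] by simp
    finally have J: "integral {0..1} ?J = integral {0..1} (\<lambda>x. integral {0..1} (G x))" .
    have "?I - integral {0..1} ?J = integral {0..1} (\<lambda>x. ?I - ?J x)"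
      using integral_diff[of "\<lambda>x. ?I" "{0..1}" ?J] contJ by (simp add: integrable_continuous_real)
    also have "norm \<dots> \<le> e * (1 - 0)"
      by (rule integral_bound) (use bound in \<open>auto intro!: continuous_intros contJ\<close>)
    finally show ?thesis unfolding J by simp
  qed
  moreover have "n0 > 0" by (simp add: n0_def)
  ultimately show ?thesis by blast
qed

text \<open>Uniform continuity bounds the error on each cell by \<open>e\<close> times its length as
  soon as the mesh \<open>1 / N\<close> is below the modulus \<open>d\<close>.\<close>

lemma riemann_sum_tendsto_integral:
  fixes g :: "real \<Rightarrow> real"
  assumes cont: "continuous_on {0..1} g"
  shows "(\<lambda>N. (\<Sum>i<N. g (real i / real N)) / real N) \<longlonglongrightarrow> integral {0..1} g"
proof (rule LIMSEQ_I)
  fix r :: real assume "r > 0"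
  define e where "e = r / 2"
  have e: "e > 0" using \<open>r > 0\<close> by (simp add: e_def)
  have "uniformly_continuous_on {0..1} g"
    by (intro compact_uniformly_continuous cont) auto
  then obtain d where d: "d > 0"
    "\<And>x y. x \<in> {0..1} \<Longrightarrow> y \<in> {0..1} \<Longrightarrow> dist y x < d \<Longrightarrow> dist (g y) (g x) < e"
    using e unfolding uniformly_continuous_on_def by metis
  obtain N0 :: nat where N0: "1 / d < real N0" using reals_Archimedean2 by blast
  have "norm ((\<Sum>i<N. g (real i / real N)) / real N - integral {0..1} g) < r" if N: "N \<ge> N0" for N
  proof -
    have "1 / d > 0" using d by simp
    then have Npos: "real N > 0" using N0 N by linarith
    have Nd: "1 / real N < d"
    proof -
      have "1 / d < real N" using N0 N by linarith
      then show ?thesis using d Npos by (simp add: field_simps)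
    qed
    \<comment> \<open>Induction over the number of cells covered: the accumulated error is at most
      \<open>e\<close> times the covered length.\<close>
    have "\<bar>integral {0..real k / real N} g - (\<Sum>i<k. g (real i / real N)) / real N\<bar> \<le> e * (real k / real N)"
      if "k \<le> N" for k
      using that
    proof (induction k)
      case (Suc k)
      let ?a = "real k / real N" and ?b = "real (Suc k) / real N"
      have ab: "?a \<le> ?b" "0 \<le> ?a" "?b \<le> 1" "?b - ?a = 1 / real N"
        using Suc.prems Npos by (auto simp: divide_right_mono field_simps)
      have c: "continuous_on {?a..?b} g" by (rule continuous_on_subset[OF cont]) (use ab in auto)
      have "integral {0..?b} g = integral {0..?a} g + integral {?a..?b} g"
        by (rule Henstock_Kurzweil_Integration.integral_combine[symmetric])
          (use ab in \<open>auto intro!: integrable_continuous_real continuous_on_subset[OF cont]\<close>)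
      moreover have "\<bar>integral {?a..?b} g - g ?a / real N\<bar> \<le> e * (?b - ?a)"
      proof -
        have "integral {?a..?b} g - g ?a / real N = integral {?a..?b} (\<lambda>x. g x - g ?a)"
          using ab c by (subst integral_diff) (auto intro!: integrable_continuous_real simp: field_simps)
        also have "norm \<dots> \<le> e * (?b - ?a)"
        proof (rule integral_bound)
          fix x assume "x \<in> {?a..?b}"
          then have "?a \<le> x" "x \<le> ?b" by auto
          then have "0 \<le> x" "x \<le> 1" "\<bar>x - ?a\<bar> < d" using ab Nd by linarith+
          then have "x \<in> {0..1}" "dist x ?a < d" by (auto simp: dist_real_def)
          then show "norm (g x - g ?a) \<le> e"
            using d(2)[of ?a x] ab by (simp add: dist_real_def)
        qed (use ab c in \<open>auto intro!: continuous_intros\<close>)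
        finally show ?thesis by simp
      qed
      moreover have "e * ?b = e * ?a + e * (?b - ?a)" by (simp add: algebra_simps)
      ultimately show ?case
        using Suc.IH Suc.prems by (simp add: add_divide_distrib)
    qed simp
    from this[of N] have "\<bar>integral {0..1} g - (\<Sum>i<N. g (real i / real N)) / real N\<bar> \<le> e"
      using Npos by simp
    then show ?thesis using \<open>r > 0\<close> unfolding e_def by (simp add: abs_minus_commute)
  qed
  then show "\<exists>N0. \<forall>N\<ge>N0. norm ((\<Sum>i<N. g (real i / real N)) / real N - integral {0..1} g) < r"
    by blast
qed

section \<open>The periodic force is continuously differentiable\<close>

text \<open>At \<open>d = 0\<close> the quotient is \<open>0 / 0 = 0\<close>, which is also its limit.\<close>
definition radial_partial :: "(real \<Rightarrow> real) \<Rightarrow> (real \<Rightarrow> real) \<Rightarrow> 2 \<Rightarrow> 2 \<Rightarrow> real^2 \<Rightarrow> real" where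
  "radial_partial f f' i c d =
     f (norm d) * (if i = c then 1 else 0) + f' (norm d) * (d $ i * d $ c / norm d)"

text \<open>Away from the origin this is the chain rule. At the origin the norm is not
  differentiable, but the difference quotient is \<open>f \<bar>h\<bar>\<close> times a constant,
  and continuity of \<open>f\<close> suffices.\<close>

lemma radial_partial_deriv:
  assumes der: "\<And>s. s \<ge> 0 \<Longrightarrow> (f has_real_derivative f' s) (at s within {0..})"
  shows "((\<lambda>t. f (norm (d + t *\<^sub>R axis i 1)) * (d + t *\<^sub>R axis i 1) $ c)
           has_real_derivative radial_partial f f' i c d) (at 0)"
proof (cases "d = 0")
  case True
  have "continuous_on {0..} f"
    by (rule DERIV_continuous_on[of _ _ f']) (auto intro: der)
  then have "continuous_on UNIV (\<lambda>h. f \<bar>h\<bar>)"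
    by (rule continuous_on_compose2) (auto intro: continuous_intros)
  then have "(\<lambda>h. f \<bar>h\<bar>) \<midarrow>0\<rightarrow> f \<bar>0\<bar>"
    unfolding continuous_on_def by blast
  then have "(\<lambda>h. f \<bar>h\<bar> * axis i 1 $ c) \<midarrow>0\<rightarrow> f 0 * axis i 1 $ c"
    by (auto intro: tendsto_mult_right)
  then have "(\<lambda>h. (f \<bar>h\<bar> * (h * axis i 1 $ c) - 0) / h) \<midarrow>0\<rightarrow> f 0 * axis i 1 $ c"
    by (rule Lim_transform_eventually) (auto simp: eventually_at_filter)
  moreover have "(axis i 1 :: real^2) $ c = (if i = c then 1 else 0)"
    by (simp add: axis_def)
  ultimately show ?thesis
    using True by (simp add: DERIV_def radial_partial_def)
next
  case False
  then have "norm d > 0" by simp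
  then have "(f has_real_derivative f' (norm d)) (at (norm d))"
    using der[of "norm d"] by (simp add: at_within_interior[of _ "{0..}"])
  moreover have "((\<lambda>t. norm (d + t *\<^sub>R axis i 1)) has_real_derivative d $ i / norm d) (at 0)"
  proof -
    have "((\<lambda>t. norm (d + t *\<^sub>R axis i 1)) has_derivative
        (\<lambda>t. (t *\<^sub>R axis i 1) \<bullet> sgn (d + 0 *\<^sub>R axis i 1))) (at 0)"
      by (rule has_derivative_compose[where g = norm, OF _ has_derivative_norm])
        (use False in \<open>auto intro!: derivative_eq_intros\<close>)
    then show ?thesis
      unfolding has_field_derivative_def
      by (rule has_derivative_eq_rhs) (auto simp: sgn_div_norm inner_axis' divide_inverse)
  qed
  ultimately have "((\<lambda>t. f (norm (d + t *\<^sub>R axis i 1))) has_real_derivative f' (norm d) * (d $ i / norm d)) (at 0)"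
    using DERIV_chain2[of f "f' (norm d)" "\<lambda>t. norm (d + t *\<^sub>R axis i 1)" 0 "d $ i / norm d"] by simp
  moreover have "((\<lambda>t. (d + t *\<^sub>R axis i 1) $ c) has_real_derivative axis i 1 $ c) (at 0)"
    by (auto intro!: derivative_eq_intros)
  ultimately show ?thesis
    by (rule DERIV_cong[OF DERIV_mult]) (simp add: radial_partial_def axis_def)
qed

text \<open>Only the origin is critical, where
  \<open>\<bar>d $ i * d $ c\<bar> / norm d \<le> norm d\<close> forces the quotient to 0.\<close>

lemma continuous_radial_partial:
  assumes f: "continuous_on {0..} f" and f': "continuous_on {0..} f'"
  shows "continuous_on UNIV (radial_partial f f' i c)"
proof -
  have q: "continuous_on UNIV (\<lambda>d::real^2. d $ i * d $ c / norm d)"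
  proof (rule continuous_at_imp_continuous_on, safe)
    fix d :: "real^2"
    show "isCont (\<lambda>d. d $ i * d $ c / norm d) d"
    proof (cases "d = 0")
      case True
      have "((\<lambda>d::real^2. d $ i * d $ c / norm d) \<longlongrightarrow> 0) (at 0)"
      proof (rule Lim_null_comparison)
        show "\<forall>\<^sub>F d::real^2 in at 0. norm (d $ i * d $ c / norm d) \<le> norm d"
        proof (rule always_eventually, rule allI)
          fix d :: "real^2"
          have "\<bar>d $ i\<bar> * \<bar>d $ c\<bar> \<le> norm d * norm d"
            by (intro mult_mono component_le_norm_cart) auto
          then show "norm (d $ i * d $ c / norm d) \<le> norm d"
            by (cases "d = 0") (auto simp: abs_mult divide_le_eq)
        qed
        show "((\<lambda>d::real^2. norm d) \<longlongrightarrow> 0) (at 0)" by (rule tendsto_norm_zero) simp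
      qed
      then show ?thesis using True by (simp add: isCont_def)
    next
      case False
      then show ?thesis by (intro continuous_intros) auto
    qed
  qed
  have "continuous_on UNIV (\<lambda>d::real^2. f (norm d))" "continuous_on UNIV (\<lambda>d::real^2. f' (norm d))"
    by (rule continuous_on_compose2[OF f] continuous_on_compose2[OF f'], auto intro: continuous_intros)+
  then show ?thesis
    unfolding radial_partial_def
    by (intro continuous_on_add continuous_on_mult q continuous_on_const)
qed

lemma has_vector_derivative_2:
  fixes F :: "real \<Rightarrow> real^2" and D :: "real^2"
  assumes "\<And>c. ((\<lambda>t. F t $ c) has_real_derivative D $ c) (at x)"
  shows "(F has_vector_derivative D) (at x)"
proof -
  have eq: "v $ 1 *\<^sub>R axis 1 1 + v $ 2 *\<^sub>R axis 2 1 = v" for v :: "real^2"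
    by (simp add: vec_eq_iff forall_2 axis_def)
  have "((\<lambda>t. F t $ 1 *\<^sub>R (axis 1 1 :: real^2) + F t $ 2 *\<^sub>R axis 2 1) has_vector_derivative
     D $ 1 *\<^sub>R axis 1 1 + D $ 2 *\<^sub>R axis 2 1) (at x)"
    using assms[of 1] assms[of 2]
    by (auto intro!: derivative_eq_intros)
  then show ?thesis by (simp only: eq)
qed

section \<open>Lattice sums for the periodised force\<close>

definition lattice_point :: "int \<times> int \<Rightarrow> real^2" where
  "lattice_point p = vector [of_int (fst p), of_int (snd p)]"

lemma lattice_point_nth [simp]:
  "lattice_point p $ 1 = of_int (fst p)" "lattice_point p $ 2 = of_int (snd p)"
  by (simp_all add: lattice_point_def)

text \<open>Every lattice point other than the rounded one leaves \<open>d\<close> at distance at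
  least 1/2, hence outside the support of the force.\<close>

lemma exists_large_component_off_cell:
  assumes "p \<noteq> (round (d $ 1), round (d $ 2))"
  shows "\<exists>i. 1/2 \<le> \<bar>(d - lattice_point p) $ i\<bar>"
proof -
  have *: "1/2 \<le> \<bar>x - of_int k\<bar>" if "k \<noteq> round x" for x :: real and k
    using round_unique'[of x k] that by force
  from assms have "fst p \<noteq> round (d $ 1) \<or> snd p \<noteq> round (d $ 2)" by (cases p) auto
  then show ?thesis
    using *[of "fst p" "d $ 1"] *[of "snd p" "d $ 2"]
    by (auto intro: exI[of _ 1] exI[of _ 2])
qed

text \<open>Collects regularity and cutoff, with the derivatives as parameters. Sign conditions on
  the coefficients appear as hypotheses of the lemmas that use them.\<close>

locale cutoff_force =
  fixes Rc :: real and fl fs fl' fs' :: "real \<Rightarrow> real"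
  assumes Rc_pos: "0 < Rc" and Rc_le: "Rc \<le> 1/2"
    and fl_deriv: "\<And>s. s \<ge> 0 \<Longrightarrow> (fl has_real_derivative fl' s) (at s within {0..})"
    and fs_deriv: "\<And>s. s \<ge> 0 \<Longrightarrow> (fs has_real_derivative fs' s) (at s within {0..})"
    and fl'_cont: "continuous_on {0..} fl'" and fs'_cont: "continuous_on {0..} fs'"
    and fl_cutoff: "\<And>s. s \<ge> Rc \<Longrightarrow> fl s = 0" and fs_cutoff: "\<And>s. s \<ge> Rc \<Longrightarrow> fs s = 0"
begin

text \<open>Indexing the coefficient by the force component lets one argument treat both
  components.\<close>

definition coef :: "2 \<Rightarrow> real \<Rightarrow> real" where "coef c = (if c = 1 then fl else fs)"
definition coef' :: "2 \<Rightarrow> real \<Rightarrow> real" where "coef' c = (if c = 1 then fl' else fs')"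

lemma coef_deriv: "s \<ge> 0 \<Longrightarrow> (coef c has_real_derivative coef' c s) (at s within {0..})"
  using fl_deriv fs_deriv by (simp add: coef_def coef'_def)

lemma coef_cont: "continuous_on {0..} (coef c)"
  by (rule DERIV_continuous_on[of _ _ "coef' c"]) (auto intro: coef_deriv)

lemma coef'_cont: "continuous_on {0..} (coef' c)"
  using fl'_cont fs'_cont by (simp add: coef'_def)

lemma coef_cutoff: "s \<ge> Rc \<Longrightarrow> coef c s = 0"
  using fl_cutoff fs_cutoff by (simp add: coef_def)

text \<open>Beyond \<open>Rc\<close> the coefficient is locally constant; at \<open>Rc\<close>
  itself the value follows from continuity of the derivative.\<close>

lemma coef'_cutoff:
  assumes "s \<ge> Rc" shows "coef' c s = 0"
proof -
  have gt: "coef' c s = 0" if "s > Rc" for s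
  proof (rule DERIV_unique)
    show "(coef c has_real_derivative coef' c s) (at s)"
      using coef_deriv[of s c] that Rc_pos by (simp add: at_within_interior[of _ "{0..}"])
    have "((\<lambda>_. 0) has_real_derivative 0) (at s)" by simp
    then show "(coef c has_real_derivative 0) (at s)"
      by (rule has_field_derivative_transform_within_open[of _ _ _ "{Rc<..}"])
        (use that coef_cutoff in auto)
  qed
  have "closure {Rc<..} = {Rc..}" by simp
  moreover have "coef' c ` closure {Rc<..} \<subseteq> {0}"
    by (rule image_closure_subset)
      (use gt Rc_pos in \<open>auto intro!: continuous_on_subset[OF coef'_cont]\<close>)
  ultimately show ?thesis using assms by auto
qed

lemma force_nth: "force fl fs d $ c = coef c (norm d) * d $ c"
  using exhaust_2[of c] by (auto simp: force_def coef_def)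

lemma force_eq_0: "1/2 \<le> \<bar>d $ i\<bar> \<Longrightarrow> force fl fs d = 0"
  using component_le_norm_cart[of d i] Rc_le by (simp add: vec_eq_iff force_nth coef_cutoff)

lemma radial_partial_eq_0: "1/2 \<le> \<bar>d $ j\<bar> \<Longrightarrow> radial_partial (coef c) (coef' c) i c d = 0"
  using component_le_norm_cart[of d j] Rc_le by (simp add: radial_partial_def coef_cutoff coef'_cutoff)

abbreviation lattice_box :: "nat \<Rightarrow> (int \<times> int) set" where
  "lattice_box B \<equiv> {- int B - 1..int B + 1} \<times> {- int B - 1..int B + 1}"

text \<open>All terms except that of the rounded lattice point vanish. The finite sum has no
  discontinuous rounding and can be differentiated term by term.\<close>

lemma periodic_force_eq_lattice_sum:
  assumes "\<And>i. \<bar>d $ i\<bar> \<le> real B"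
  shows "periodic_force fl fs d = (\<Sum>p\<in>lattice_box B. force fl fs (d - lattice_point p))"
proof -
  let ?p = "(round (d $ 1), round (d $ 2))"
  have "\<bar>round x\<bar> \<le> int B + 1" if "\<bar>x\<bar> \<le> real B" for x :: real
    using that of_int_round_ge[of x] of_int_round_le[of x] by linarith
  then have "?p \<in> lattice_box B" using assms[of 1] assms[of 2] by (force simp: abs_le_iff)
  then have "(\<Sum>p\<in>lattice_box B. force fl fs (d - lattice_point p)) =
      force fl fs (d - lattice_point ?p) + (\<Sum>p\<in>lattice_box B - {?p}. force fl fs (d - lattice_point p))"
    by (subst sum.remove[of _ ?p]) auto
  also have "(\<Sum>p\<in>lattice_box B - {?p}. force fl fs (d - lattice_point p)) = 0"
    by (rule sum.neutral) (use exists_large_component_off_cell[of _ d] force_eq_0 in blast)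
  also have "d - lattice_point ?p = (\<chi> i. d $ i - of_int (round (d $ i)))"
    by (simp add: vec_eq_iff forall_2)
  finally show ?thesis by (simp add: periodic_force_def)
qed

text \<open>The strict bound persists for small \<open>t\<close>, so the same finite sum represents
  the force near \<open>t = 0\<close>.\<close>

lemma periodic_force_deriv_lattice_sum:
  assumes "\<And>i. \<bar>d $ i\<bar> < real B"
  shows "((\<lambda>t. periodic_force fl fs (d + t *\<^sub>R axis i 1) $ c) has_real_derivative
    (\<Sum>p\<in>lattice_box B. radial_partial (coef c) (coef' c) i c (d - lattice_point p))) (at 0)"
proof -
  have "((\<lambda>t. \<Sum>p\<in>lattice_box B. force fl fs (d - lattice_point p + t *\<^sub>R axis i 1) $ c) has_real_derivative
    (\<Sum>p\<in>lattice_box B. radial_partial (coef c) (coef' c) i c (d - lattice_point p))) (at 0)"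
    unfolding force_nth by (intro DERIV_sum radial_partial_deriv coef_deriv)
  moreover have "\<forall>\<^sub>F t in nhds 0. \<bar>(d + t *\<^sub>R axis i 1) $ j\<bar> < real B" for j
  proof (rule order_tendstoD)
    have "((\<lambda>t. \<bar>(d + t *\<^sub>R axis i 1) $ j\<bar>) \<longlongrightarrow> \<bar>(d + 0 *\<^sub>R axis i 1) $ j\<bar>) (nhds 0)"
      by (intro tendsto_intros filterlim_ident)
    then show "((\<lambda>t. \<bar>(d + t *\<^sub>R axis i 1) $ j\<bar>) \<longlongrightarrow> \<bar>d $ j\<bar>) (nhds 0)" by simp
  qed (rule assms)
  then have "\<forall>\<^sub>F t in nhds 0. \<forall>j. \<bar>(d + t *\<^sub>R axis i 1) $ j\<bar> < real B"
    by (rule eventually_all_finite)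
  then have "\<forall>\<^sub>F t in nhds 0. (\<Sum>p\<in>lattice_box B. force fl fs (d - lattice_point p + t *\<^sub>R axis i 1) $ c)
      = periodic_force fl fs (d + t *\<^sub>R axis i 1) $ c"
    by eventually_elim
      (subst periodic_force_eq_lattice_sum[of _ B], auto simp: less_imp_le algebra_simps)
  ultimately show ?thesis
    by (simp add: DERIV_cong_ev)
qed

lemma partial_force_eq_lattice_sum:
  assumes "\<And>i. \<bar>d $ i\<bar> < real B"
  shows "partial_force fl fs i d $ c =
    (\<Sum>p\<in>lattice_box B. radial_partial (coef c) (coef' c) i c (d - lattice_point p))"
proof -
  have "((\<lambda>t. periodic_force fl fs (d + t *\<^sub>R axis i 1)) has_vector_derivative
    (\<chi> c. \<Sum>p\<in>lattice_box B. radial_partial (coef c) (coef' c) i c (d - lattice_point p))) (at 0)"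
    by (rule has_vector_derivative_2) (simp add: periodic_force_deriv_lattice_sum[OF assms])
  then show ?thesis
    by (simp add: partial_force_def vector_derivative_at)
qed

lemma exists_box_bound:
  fixes d :: "real^2"
  obtains B :: nat where "\<And>i. \<bar>d $ i\<bar> < real B"
proof -
  obtain B :: nat where "norm d < real B" using reals_Archimedean2 by blast
  then show ?thesis using that le_less_trans[OF component_le_norm_cart] by blast
qed

lemma partial_force_deriv:
  "((\<lambda>t. periodic_force fl fs (d + t *\<^sub>R axis i 1) $ c) has_real_derivative
     partial_force fl fs i (d + x *\<^sub>R axis i 1) $ c) (at x)"
proof -
  let ?d = "d + x *\<^sub>R axis i 1"
  obtain B :: nat where B: "\<And>j. \<bar>?d $ j\<bar> < real B" using exists_box_bound[of ?d] by blast
  have "((\<lambda>t. periodic_force fl fs (?d + t *\<^sub>R axis i 1) $ c) has_real_derivative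
     partial_force fl fs i ?d $ c) (at 0)"
    using periodic_force_deriv_lattice_sum[OF B] partial_force_eq_lattice_sum[OF B] by simp
  then have "((\<lambda>t. periodic_force fl fs (d + (t + x) *\<^sub>R axis i 1) $ c) has_real_derivative
     partial_force fl fs i ?d $ c) (at 0)"
    by (simp add: scaleR_add_left add_ac)
  then show ?thesis
    using DERIV_shift[of "\<lambda>t. periodic_force fl fs (d + t *\<^sub>R axis i 1) $ c" _ 0 x] by simp
qed

text \<open>The open boxes \<open>?S B\<close> exhaust the plane, and on each of them the derivative
  is a finite sum of continuous terms.\<close>

lemma continuous_partial_force: "continuous_on UNIV (partial_force fl fs i)"
proof -
  have "continuous_on UNIV (\<lambda>d. partial_force fl fs i d $ c)" for c
  proof -
    let ?S = "\<lambda>B::nat. {d::real^2. \<forall>j. \<bar>d $ j\<bar> < real B}"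
    have "continuous_on (\<Union>B. ?S B) (\<lambda>d. partial_force fl fs i d $ c)"
    proof (rule continuous_on_open_UN)
      fix B
      have "?S B = (\<Inter>j. {d. \<bar>d $ j\<bar> < real B})" by auto
      then show "open (?S B)"
        by (auto intro!: open_INT open_Collect_less continuous_intros)
      have "continuous_on (?S B)
        (\<lambda>d. \<Sum>p\<in>lattice_box B. radial_partial (coef c) (coef' c) i c (d - lattice_point p))"
        by (intro continuous_on_sum
            continuous_on_compose2[OF continuous_radial_partial[OF coef_cont coef'_cont]] continuous_intros) auto
      then show "continuous_on (?S B) (\<lambda>d. partial_force fl fs i d $ c)"
        by (rule continuous_on_eq) (rule partial_force_eq_lattice_sum[symmetric], blast)
    qed
    moreover have "d \<in> (\<Union>B. ?S B)" for d
    proof -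
      obtain B :: nat where "\<And>j. \<bar>d $ j\<bar> < real B" using exists_box_bound[of d] by blast
      then show ?thesis by auto
    qed
    then have "(\<Union>B. ?S B) = UNIV" by auto
    ultimately show ?thesis by simp
  qed
  then have "continuous_on UNIV (\<lambda>d. \<chi> c. partial_force fl fs i d $ c)"
    by (rule continuous_on_vec_lambda)
  then show ?thesis by simp
qed

text \<open>On the boundary of the closed square rounding may select a nonzero lattice point. This
  version singles out the origin there too, so that the periodic force agrees with the original one
  on the whole closed square.\<close>

lemma shifted_component_ge_half:
  fixes d :: "real^2"
  assumes d: "\<And>i. \<bar>d $ i\<bar> \<le> 1/2" and p: "p \<noteq> (0, 0)"
  shows "\<exists>j. 1/2 \<le> \<bar>(d - lattice_point p) $ j\<bar>"
proof -
  have *: "1/2 \<le> \<bar>x - of_int k\<bar>" if "\<bar>x\<bar> \<le> 1/2" "k \<noteq> 0" for x :: real and k :: int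
  proof -
    have "1 \<le> \<bar>k\<bar>" using that by linarith
    then have "1 \<le> \<bar>of_int k :: real\<bar>" by (metis of_int_1_le_iff of_int_abs)
    then show ?thesis using that by linarith
  qed
  from p have "fst p \<noteq> 0 \<or> snd p \<noteq> 0" by (cases p) auto
  then show ?thesis
    using *[OF d[of 1], of "fst p"] *[OF d[of 2], of "snd p"]
    by (auto intro: exI[of _ 1] exI[of _ 2])
qed

lemma lattice_point_0 [simp]: "lattice_point (0, 0) = 0"
  by (simp add: vec_eq_iff forall_2)

lemma periodic_force_on_square:
  assumes "\<And>i. \<bar>d $ i\<bar> \<le> 1/2"
  shows "periodic_force fl fs d = force fl fs d"
proof -
  have "periodic_force fl fs d = (\<Sum>p\<in>lattice_box 1. force fl fs (d - lattice_point p))"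
    by (rule periodic_force_eq_lattice_sum) (rule order_trans[OF assms], simp)
  also have "\<dots> = force fl fs (d - lattice_point (0, 0)) +
      (\<Sum>p\<in>lattice_box 1 - {(0, 0)}. force fl fs (d - lattice_point p))"
    by (subst sum.remove[of _ "(0, 0)"]) auto
  also have "(\<Sum>p\<in>lattice_box 1 - {(0, 0)}. force fl fs (d - lattice_point p)) = 0"
    by (rule sum.neutral) (use shifted_component_ge_half[OF assms] force_eq_0 in blast)
  finally show ?thesis by simp
qed

lemma partial_force_on_square:
  assumes "\<And>i. \<bar>d $ i\<bar> \<le> 1/2"
  shows "partial_force fl fs i d $ c = radial_partial (coef c) (coef' c) i c d"
proof -
  have "\<bar>d $ i\<bar> < real 1" for i using assms[of i] by simp
  then have "partial_force fl fs i d $ c =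
      (\<Sum>p\<in>lattice_box 1. radial_partial (coef c) (coef' c) i c (d - lattice_point p))"
    by (rule partial_force_eq_lattice_sum)
  also have "\<dots> = radial_partial (coef c) (coef' c) i c (d - lattice_point (0, 0)) +
      (\<Sum>p\<in>lattice_box 1 - {(0, 0)}. radial_partial (coef c) (coef' c) i c (d - lattice_point p))"
    by (subst sum.remove[of _ "(0, 0)"]) auto
  also have "(\<Sum>p\<in>lattice_box 1 - {(0, 0)}. radial_partial (coef c) (coef' c) i c (d - lattice_point p)) = 0"
    by (rule sum.neutral) (use shifted_component_ge_half[OF assms] radial_partial_eq_0 in blast)
  finally show ?thesis by simp
qed

text \<open>Rounding does not commute with negation at half-integers, so oddness is read off the
  lattice sum, whose index set is symmetric under negation.\<close>

lemma periodic_force_minus: "periodic_force fl fs (- d) = - periodic_force fl fs d"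
proof -
  obtain B :: nat where B: "\<And>j. \<bar>d $ j\<bar> < real B" using exists_box_bound[of d] by blast
  have odd: "force fl fs (- x) = - force fl fs x" for x
    by (simp add: vec_eq_iff force_nth)
  have "periodic_force fl fs (- d) = (\<Sum>p\<in>lattice_box B. force fl fs (- d - lattice_point p))"
    by (rule periodic_force_eq_lattice_sum) (simp add: B less_imp_le)
  also have "\<dots> = (\<Sum>p\<in>lattice_box B. force fl fs (- (d - lattice_point p)))"
  proof (rule sum.reindex_bij_witness[of _ "\<lambda>p. (- fst p, - snd p)" "\<lambda>p. (- fst p, - snd p)"])
    fix p :: "int \<times> int"
    have "- (d - lattice_point (- fst p, - snd p)) = - d - lattice_point p"
      by (simp add: vec_eq_iff forall_2)
    then show "force fl fs (- (d - lattice_point (- fst p, - snd p))) = force fl fs (- d - lattice_point p)"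
      by (rule arg_cong)
  qed auto
  also have "\<dots> = - periodic_force fl fs d"
    unfolding odd sum_negf
    by (subst periodic_force_eq_lattice_sum[of d B]) (simp_all add: B less_imp_le)
  finally show ?thesis .
qed

lemma periodic_force_add_lattice_point:
  "periodic_force fl fs (d + lattice_point p) = periodic_force fl fs d"
proof -
  have r: "x + of_int k - of_int (round (x + of_int k)) = x - of_int (round x)" for x :: real and k
  proof -
    have "round (x + of_int k) = \<lfloor>(x + 1/2) + of_int k\<rfloor>"
      unfolding round_def by (rule arg_cong[of _ _ floor]) simp
    also have "\<dots> = round x + k" by (simp add: round_def)
    finally have "round (x + of_int k) = round x + k" .
    then show ?thesis by simp
  qed
  have "(\<chi> i. (d + lattice_point p) $ i - of_int (round ((d + lattice_point p) $ i))) =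
      (\<chi> i. d $ i - of_int (round (d $ i)))"
    unfolding vec_eq_iff forall_2 vec_lambda_beta vector_add_component lattice_point_nth r by simp
  then show ?thesis by (simp only: periodic_force_def)
qed

lemma partial_force_add_lattice_point:
  "partial_force fl fs i (d + lattice_point p) = partial_force fl fs i d"
proof -
  have "periodic_force fl fs (d + lattice_point p + x) = periodic_force fl fs (d + x)" for x
    using periodic_force_add_lattice_point[of "d + x" p] by (simp add: add_ac)
  then show ?thesis by (simp add: partial_force_def)
qed

end

section \<open>The divergence on lines\<close>

lemma vector2_eq_axis: "(vector [u, v] :: real^2) = u *\<^sub>R axis 1 1 + v *\<^sub>R axis 2 1"
  by (simp add: vec_eq_iff forall_2 axis_def)

lemma norm_vector2: "norm (vector [u, v] :: real^2) = sqrt (u\<^sup>2 + v\<^sup>2)"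
  by (simp add: norm_vec_def L2_set_def sum_2)

context cutoff_force
begin

text \<open>Only the diagonal derivatives enter the trace. Taking two real arguments allows
  integration in one coordinate at a time.\<close>

definition partial11 :: "real \<Rightarrow> real \<Rightarrow> real" where
  "partial11 u v = partial_force fl fs 1 (vector [u, v]) $ 1"

definition partial22 :: "real \<Rightarrow> real \<Rightarrow> real" where
  "partial22 u v = partial_force fl fs 2 (vector [u, v]) $ 2"

lemma continuous_partial11_partial22:
  assumes "continuous_on S f" "continuous_on S g"
  shows "continuous_on S (\<lambda>z. partial11 (f z) (g z))" "continuous_on S (\<lambda>z. partial22 (f z) (g z))"
proof -
  have "continuous_on S (\<lambda>z. vector [f z, g z] :: real^2)"
    unfolding vector2_eq_axis by (intro continuous_intros assms)
  then show "continuous_on S (\<lambda>z. partial11 (f z) (g z))" "continuous_on S (\<lambda>z. partial22 (f z) (g z))"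
    unfolding partial11_def partial22_def
    by (intro continuous_intros continuous_on_compose2[OF continuous_partial_force]; simp)+
qed

lemma vector2_add_1:
  "(vector [u + 1, v] :: real^2) = vector [u, v] + lattice_point (1, 0)"
  "(vector [u, v + 1] :: real^2) = vector [u, v] + lattice_point (0, 1)"
  by (simp_all add: vec_eq_iff forall_2)

lemma partial11_partial22_periodic [simp]:
  "partial11 (u + 1) v = partial11 u v" "partial11 u (v + 1) = partial11 u v"
  "partial22 (u + 1) v = partial22 u v" "partial22 u (v + 1) = partial22 u v"
  by (simp_all only: partial11_def partial22_def vector2_add_1 partial_force_add_lattice_point)

lemma periodic_force_periodic [simp]:
  "periodic_force fl fs (vector [u + 1, v]) = periodic_force fl fs (vector [u, v])"
  "periodic_force fl fs (vector [u, v + 1]) = periodic_force fl fs (vector [u, v])"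
  by (simp_all only: vector2_add_1 periodic_force_add_lattice_point)

lemma periodic_force_has_derivative_1:
  "((\<lambda>u. periodic_force fl fs (vector [u, v]) $ c) has_real_derivative
    partial_force fl fs 1 (vector [u, v]) $ c) (at u)"
  using partial_force_deriv[of "v *\<^sub>R axis 2 1" 1 c u] by (simp add: vector2_eq_axis add.commute)

lemma periodic_force_has_derivative_2:
  "((\<lambda>v. periodic_force fl fs (vector [u, v]) $ c) has_real_derivative
    partial_force fl fs 2 (vector [u, v]) $ c) (at v)"
  using partial_force_deriv[of "u *\<^sub>R axis 1 1" 2 c v] by (simp add: vector2_eq_axis)

section \<open>Integrals over periods and values on the axes\<close>

lemma integral_partial11:
  assumes "a \<le> b"
  shows "integral {a..b} (\<lambda>u. partial11 u v) =
    periodic_force fl fs (vector [b, v]) $ 1 - periodic_force fl fs (vector [a, v]) $ 1"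
  unfolding partial11_def
  by (intro integral_unique fundamental_theorem_of_calculus assms)
    (metis periodic_force_has_derivative_1 has_real_derivative_iff_has_vector_derivative
      has_vector_derivative_at_within)

text \<open>The force has the same value at both ends of a period. This removes
  \<open>partial22\<close> from averages over the torus.\<close>

lemma integral_partial22_period: "integral {0..1} (partial22 u) = 0"
proof -
  have "integral {0..1} (\<lambda>v. partial22 u v) =
    periodic_force fl fs (vector [u, 1]) $ 2 - periodic_force fl fs (vector [u, 0]) $ 2"
    unfolding partial22_def
    by (intro integral_unique fundamental_theorem_of_calculus)
      (use periodic_force_has_derivative_2 in \<open>auto simp: has_real_derivative_iff_has_vector_derivative
        intro: has_vector_derivative_at_within\<close>)
  also have "\<dots> = 0" using periodic_force_periodic(2)[of u 0] by simp
  finally show ?thesis by simp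
qed

lemma integral_partial11_period: "integral {0..1} (\<lambda>u. partial11 u v) = 0"
  using integral_partial11[of 0 1 v] periodic_force_periodic(1)[of 0 v] by simp

text \<open>The term with the derivative of \<open>fl\<close> carries the square of the first
  coordinate, which is 0 here.\<close>

lemma partial11_axis:
  assumes "\<bar>v\<bar> \<le> 1/2" shows "partial11 0 v = fl \<bar>v\<bar>"
proof -
  have "\<bar>(vector [0, v] :: real^2) $ i\<bar> \<le> 1/2" for i using exhaust_2[of i] assms by auto
  then have "partial11 0 v = radial_partial (coef 1) (coef' 1) 1 1 (vector [0, v])"
    unfolding partial11_def by (rule partial_force_on_square)
  also have "\<dots> = fl \<bar>v\<bar>" by (simp add: radial_partial_def coef_def norm_vector2)
  finally show ?thesis .
qed

lemma partial22_axis: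
  assumes "\<bar>u\<bar> \<le> 1/2" shows "partial22 u 0 = fs \<bar>u\<bar>"
proof -
  have "\<bar>(vector [u, 0] :: real^2) $ i\<bar> \<le> 1/2" for i using exhaust_2[of i] assms by auto
  then have "partial22 u 0 = radial_partial (coef 2) (coef' 2) 2 2 (vector [u, 0])"
    unfolding partial22_def by (rule partial_force_on_square)
  also have "\<dots> = fs \<bar>u\<bar>" by (simp add: radial_partial_def coef_def norm_vector2)
  finally show ?thesis .
qed

lemma periodic_force_square_1:
  assumes "\<bar>u\<bar> \<le> 1/2" "\<bar>v\<bar> \<le> 1/2"
  shows "periodic_force fl fs (vector [u, v]) $ 1 = fl (sqrt (u\<^sup>2 + v\<^sup>2)) * u"
proof -
  have "\<bar>(vector [u, v] :: real^2) $ i\<bar> \<le> 1/2" for i using exhaust_2[of i] assms by auto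
  then have "periodic_force fl fs (vector [u, v]) = force fl fs (vector [u, v])"
    by (rule periodic_force_on_square)
  then show ?thesis by (simp add: force_nth coef_def norm_vector2)
qed

text \<open>This is the function \<open>q\<close> of the overview, the only part of the divergence
  left in the torus average.\<close>

definition mean_partial11 :: "real \<Rightarrow> real" where "mean_partial11 u = integral {0..1} (partial11 u)"

lemma continuous_mean_partial11: "continuous_on UNIV mean_partial11"
proof -
  have "continuous_on (UNIV \<times> cbox 0 1) (\<lambda>(u, v). partial11 u v)"
    unfolding split_beta by (intro continuous_partial11_partial22 continuous_intros)
  then show ?thesis
    unfolding mean_partial11_def using integral_continuous_on_param[of UNIV 0 1 partial11] by simp
qed

lemma mean_partial11_periodic [simp]: "mean_partial11 (u + 1) = mean_partial11 u"
proof -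
  have "partial11 (u + 1) = partial11 u" by (rule ext) simp
  then show ?thesis by (simp only: mean_partial11_def)
qed

lemma integral_mean_partial11: "integral {0..1} mean_partial11 = 0"
proof -
  have "integral {0..1} mean_partial11 = integral {0..1} (\<lambda>v. integral {0..1} (\<lambda>u. partial11 u v))"
    unfolding mean_partial11_def using integral_swap_continuous[of 0 0 1 1 partial11]
    by (simp add: split_beta continuous_partial11_partial22 continuous_intros)
  then show ?thesis by (simp add: integral_partial11_period)
qed

text \<open>The sum of the cosine coefficients of \<open>mean_partial11\<close>; this is where the sign of
  \<open>\<integral> fl\<close> enters.\<close>
lemma mean_partial11_0: "mean_partial11 0 = 2 * integral {0..Rc} fl"
proof -
  have contfl: "continuous_on {0..} fl" using coef_cont[of 1] by (simp add: coef_def)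
  have "mean_partial11 0 = integral {-1/2..1/2} (partial11 0)"
    unfolding mean_partial11_def by (rule integral_symmetric_period[symmetric]) (auto intro: continuous_partial11_partial22 continuous_intros)
  also have "\<dots> = integral {-1/2..1/2} (\<lambda>v. fl \<bar>v\<bar>)"
    by (rule integral_cong) (auto simp: partial11_axis abs_le_iff)
  also have "\<dots> = integral {-1/2..0} (\<lambda>v. fl \<bar>v\<bar>) + integral {0..1/2} (\<lambda>v. fl \<bar>v\<bar>)"
    by (rule Henstock_Kurzweil_Integration.integral_combine[symmetric])
      (auto intro!: integrable_continuous_real continuous_on_compose2[OF contfl] continuous_intros)
  also have "integral {0..1/2} (\<lambda>v. fl \<bar>v\<bar>) = integral {0..1/2} fl"
    by (rule integral_cong) simp
  also have "integral {-1/2..0} (\<lambda>v. fl \<bar>v\<bar>) = integral {-1/2..0} (\<lambda>v. fl (- v))"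
    by (rule integral_cong) simp
  also have "\<dots> = integral {0..1/2} fl"
    using Henstock_Kurzweil_Integration.integral_reflect_real[of "1/2" 0 fl] by simp
  also have "integral {0..1/2} fl = integral {0..Rc} fl + integral {Rc..1/2} fl"
    by (rule Henstock_Kurzweil_Integration.integral_combine[symmetric])
      (use Rc_pos Rc_le in \<open>auto intro!: integrable_continuous_real continuous_on_subset[OF contfl]\<close>)
  also have "integral {Rc..1/2} fl = integral {Rc..1/2} (\<lambda>_. 0)"
    by (rule integral_cong) (simp add: fl_cutoff)
  finally show ?thesis by simp
qed

text \<open>Integrating first in \<open>u\<close> leaves the first force component on the two
  vertical lines at \<open>w\<close> and \<open>- w\<close>. Since \<open>w\<close> lies between
  \<open>a\<close> and \<open>Rc\<close>, all distances there exceed \<open>a\<close>, so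
  \<open>fl\<close> is nonpositive along these lines and strictly negative at
  \<open>v = 0\<close>.\<close>

lemma integral_mean_partial11_symmetric_neg:
  assumes a: "0 < a" "a < Rc" and neg: "\<And>s. a < s \<Longrightarrow> s < Rc \<Longrightarrow> fl s < 0"
  defines "w \<equiv> (a + Rc) / 2"
  shows "integral {- w..w} mean_partial11 < 0"
proof -
  have w: "0 < w" "a < w" "w < Rc" using a by (auto simp: w_def)
  then have w': "w \<le> 1/2" using Rc_le by simp
  have "integral {- w..w} mean_partial11 = integral {0..1} (\<lambda>v. integral {- w..w} (\<lambda>u. partial11 u v))"
    unfolding mean_partial11_def using integral_swap_continuous[of "- w" 0 w 1 partial11]
    by (simp add: split_beta continuous_partial11_partial22 continuous_intros)
  also have "\<dots> = integral {0..1} (\<lambda>v. periodic_force fl fs (vector [w, v]) $ 1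
      - periodic_force fl fs (vector [- w, v]) $ 1)"
    using w by (simp add: integral_partial11)
  also have "\<dots> = integral {-1/2..1/2} (\<lambda>v. periodic_force fl fs (vector [w, v]) $ 1
      - periodic_force fl fs (vector [- w, v]) $ 1)"
  proof (rule integral_symmetric_period[symmetric])
    have "continuous_on UNIV (\<lambda>v. periodic_force fl fs (vector [u, v]) $ 1)" for u
      using periodic_force_has_derivative_2[of u 1] DERIV_isCont continuous_at_imp_continuous_on by blast
    then show "continuous_on UNIV (\<lambda>v. periodic_force fl fs (vector [w, v]) $ 1
      - periodic_force fl fs (vector [- w, v]) $ 1)" by (intro continuous_on_diff)
  qed simp
  also have "\<dots> = integral {-1/2..1/2} (\<lambda>v. 2 * w * fl (sqrt (w\<^sup>2 + v\<^sup>2)))"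
    by (rule integral_cong) (use w w' in \<open>auto simp: periodic_force_square_1 abs_le_iff\<close>)
  finally have eq: "integral {- w..w} mean_partial11 = integral {-1/2..1/2} (\<lambda>v. 2 * w * fl (sqrt (w\<^sup>2 + v\<^sup>2)))" .
  let ?h = "\<lambda>v. - (2 * w * fl (sqrt (w\<^sup>2 + v\<^sup>2)))"
  have fl_le: "fl s \<le> 0" if "a < s" for s
    using neg[of s] fl_cutoff[of s] that by (cases "s < Rc") auto
  have h0: "0 \<le> ?h v" for v
  proof -
    have "w \<le> sqrt (w\<^sup>2 + v\<^sup>2)" using w by (intro real_le_rsqrt) simp
    then have "fl (sqrt (w\<^sup>2 + v\<^sup>2)) \<le> 0" using w by (intro fl_le) linarith
    then show ?thesis using w by (simp add: mult_nonneg_nonpos)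
  qed
  have contfl: "continuous_on {0..} fl" using coef_cont[of 1] by (simp add: coef_def)
  have conth: "continuous_on {-1/2..1/2} ?h"
    by (intro continuous_intros continuous_on_compose2[OF contfl]) auto
  have "integral {-1/2..1/2} ?h \<noteq> 0"
  proof
    assume "integral {-1/2..1/2} ?h = 0"
    then have "\<forall>v\<in>{-1/2..1/2}. ?h v = 0"
      by (subst integral_eq_0_iff[symmetric]) (use h0 conth in simp_all)
    from bspec[OF this, of 0] have "?h 0 = 0" by simp
    then show False using neg[of w] w by simp
  qed
  moreover have "0 \<le> integral {-1/2..1/2} ?h" by (intro integral_nonneg integrable_continuous_real conth h0)
  ultimately have "0 < integral {-1/2..1/2} ?h" by linarith
  then show ?thesis unfolding eq by (simp only: integral_neg neg_0_less_iff_less)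
qed

text \<open>An odd function would have integral zero over the symmetric interval of the preceding
  lemma.\<close>

lemma exists_mean_partial11_not_odd:
  assumes a: "0 < a" "a < Rc" and neg: "\<And>s. a < s \<Longrightarrow> s < Rc \<Longrightarrow> fl s < 0"
  obtains x0 where "mean_partial11 x0 + mean_partial11 (- x0) \<noteq> 0"
proof -
  have "\<exists>x0. mean_partial11 x0 + mean_partial11 (- x0) \<noteq> 0"
  proof (rule ccontr)
    assume "\<not> ?thesis"
    then have odd: "mean_partial11 (- x) = - mean_partial11 x" for x by (metis add_eq_0_iff)
    define w where "w = (a + Rc) / 2"
    have "integral {- w..w} mean_partial11 = integral {- w..w} (\<lambda>x. mean_partial11 (- x))"
      using Henstock_Kurzweil_Integration.integral_reflect_real[of w "- w" mean_partial11] by simp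
    also have "\<dots> = - integral {- w..w} mean_partial11" by (simp add: odd)
    finally show False using integral_mean_partial11_symmetric_neg[OF a neg] by (simp add: w_def)
  qed
  then show ?thesis using that by blast
qed

text \<open>The torus average of the integrand is \<open>e\<close>: \<open>partial22\<close>
  integrates to zero in \<open>y\<close>, \<open>mean_partial11\<close> has mean zero, and only
  minus the negative cosine coefficient remains. Equidistribution with tolerance
  \<open>e / 2\<close> keeps the line integral positive.\<close>

lemma line_integral_pos_if_small_angle:
  assumes a: "0 < a" "a < Rc" and neg: "\<And>s. a < s \<Longrightarrow> s < Rc \<Longrightarrow> fl s < 0"
    and int_fl: "integral {0..Rc} fl \<le> 0"
  shows "\<exists>k\<ge>1. \<exists>n0>0. \<forall>n::int. n0 \<le> \<bar>real_of_int n\<bar> \<longrightarrow>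
      0 < integral {0..1} (\<lambda>t. (1 - cos (2 * pi * real k * (of_int n * t))) *
        (partial11 (of_int n * t) t + partial22 (of_int n * t) t))"
proof -
  obtain x0 where "mean_partial11 x0 + mean_partial11 (- x0) \<noteq> 0" using exists_mean_partial11_not_odd[OF a neg] by blast
  moreover have "mean_partial11 0 \<le> 0" using int_fl by (simp add: mean_partial11_0)
  ultimately obtain k :: nat where k: "k \<ge> 1" "integral {0..1} (\<lambda>u. cos (2 * pi * real k * u) * mean_partial11 u) < 0"
    using exists_negative_cos_integral[OF continuous_mean_partial11 mean_partial11_periodic integral_mean_partial11] by blast
  define e where "e = - integral {0..1} (\<lambda>u. cos (2 * pi * real k * u) * mean_partial11 u)"
  have e: "e > 0" using k by (simp add: e_def)
  let ?G = "\<lambda>x y. (1 - cos (2 * pi * real k * x)) * (partial11 x y + partial22 x y)"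
  have mean: "integral {0..1} (\<lambda>x. integral {0..1} (?G x)) = e"
  proof -
    have int: "partial11 x integrable_on {0..1}" "partial22 x integrable_on {0..1}" for x
      by (auto intro!: integrable_continuous_real continuous_partial11_partial22 continuous_intros)
    have "integral {0..1} (?G x) = (1 - cos (2 * pi * real k * x)) * mean_partial11 x" for x
      by (simp add: integral_add int integral_partial22_period mean_partial11_def)
    then have "integral {0..1} (\<lambda>x. integral {0..1} (?G x)) =
        integral {0..1} (\<lambda>x. (1 - cos (2 * pi * real k * x)) * mean_partial11 x)"
      by presburger
    also have "\<dots> = integral {0..1} (\<lambda>x. mean_partial11 x - cos (2 * pi * real k * x) * mean_partial11 x)"
      by (simp add: left_diff_distrib)
    also have "\<dots> = integral {0..1} mean_partial11 - integral {0..1} (\<lambda>x. cos (2 * pi * real k * x) * mean_partial11 x)"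
      by (intro integral_diff integrable_continuous_real continuous_intros
          continuous_on_subset[OF continuous_mean_partial11]) auto
    finally show ?thesis by (simp add: integral_mean_partial11 e_def)
  qed
  have "\<exists>n0>0. \<forall>n::int. n0 \<le> \<bar>real_of_int n\<bar> \<longrightarrow>
    \<bar>integral {0..1} (\<lambda>t. ?G (of_int n * t) t) - integral {0..1} (\<lambda>x. integral {0..1} (?G x))\<bar> \<le> e / 2"
  proof (rule torus_line_equidistribution)
    show "continuous_on UNIV (\<lambda>(x, y). ?G x y)"
      unfolding split_beta by (intro continuous_intros continuous_partial11_partial22)
    have "cos (2 * pi * real k * (x + 1)) = cos (2 * pi * real k * x)" for x
    proof -
      have "2 * pi * real k * (x + 1) = 2 * pi * real k * x + 2 * pi * of_int (int k)"
        by (simp add: algebra_simps)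
      then show ?thesis
        by (simp only: cos_add cos_int_2pin sin_int_2pin mult_1_right mult_zero_right diff_zero)
    qed
    then show "?G (x + 1) y = ?G x y" for x y by simp
  qed (use e in auto)
  then obtain n0 where "n0 > 0" and n0: "\<And>n::int. n0 \<le> \<bar>real_of_int n\<bar> \<Longrightarrow>
    \<bar>integral {0..1} (\<lambda>t. ?G (of_int n * t) t) - e\<bar> \<le> e / 2"
    unfolding mean by blast
  have "0 < integral {0..1} (\<lambda>t. ?G (of_int n * t) t)" if "n0 \<le> \<bar>real_of_int n\<bar>" for n :: int
    using n0[OF that] e unfolding abs_le_iff by linarith
  then show ?thesis using k(1) \<open>n0 > 0\<close> by blast
qed

end

section \<open>Traces of the stability matrices\<close>

text \<open>The root \<open>(T + s) / 2\<close> of the characteristic polynomial, with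
  \<open>s\<close> the principal square root of the discriminant, has real part at least
  \<open>Re T / 2\<close>.\<close>

lemma has_unstable_eigenvalue_if_trace_pos:
  fixes A :: "complex^2^2"
  assumes "0 < Re (A $ 1 $ 1 + A $ 2 $ 2)"
  shows "has_unstable_eigenvalue A"
proof -
  define T where "T = A $ 1 $ 1 + A $ 2 $ 2"
  define s where "s = csqrt (T\<^sup>2 - 4 * det A)"
  define \<mu> where "\<mu> = (T + s) / 2"
  have "0 \<le> Re s" using csqrt_principal[of "T\<^sup>2 - 4 * det A"] unfolding s_def by linarith
  then have pos: "0 < Re \<mu>" using assms by (simp add: \<mu>_def T_def)
  have "s\<^sup>2 = T\<^sup>2 - 4 * det A" by (simp add: s_def)
  moreover have "s = 2 * \<mu> - T" by (simp add: \<mu>_def field_simps)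
  ultimately have "(2 * \<mu> - T)\<^sup>2 = T\<^sup>2 - 4 * det A" by simp
  then have "4 * (\<mu>\<^sup>2 - T * \<mu> + det A) = 0"
    by (simp add: power2_eq_square algebra_simps)
  then have "\<mu>\<^sup>2 - T * \<mu> + det A = 0"
    by (simp only: mult_eq_0_iff) simp
  then have "det (A - mat \<mu>) = 0"
    by (simp add: det_2 T_def mat_def power2_eq_square algebra_simps)
  then obtain v where v: "(A - mat \<mu>) *v v = 0" "v \<noteq> 0"
    using invertible_det_nz[of "A - mat \<mu>"] invertible_left_inverse[of "A - mat \<mu>"]
      matrix_left_invertible_ker[of "A - mat \<mu>"] by auto
  have "A *v v = \<mu> *s v"
    using v(1) by (simp add: vec_eq_iff forall_2 matrix_vector_mult_def sum_2 mat_def algebra_simps)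
  then show ?thesis
    using v(2) pos by (auto simp: has_unstable_eigenvalue_def is_eigenvalue_def)
qed

section \<open>Closed lines with integer cotangent\<close>

lemma line_length_direction:
  assumes \<theta>: "0 < \<theta>" "\<theta> < pi" and cot: "cot \<theta> \<in> \<int>"
  shows "line_length \<theta> *\<^sub>R direction \<theta> = vector [cot \<theta>, 1]"
proof -
  have s: "sin \<theta> > 0" using \<theta> by (rule sin_gt_zero)
  \<comment> \<open>Integrality of the second component makes \<open>l * sin \<theta>\<close> a
    positive integer, hence at least 1; at the value 1 the first component is
    \<open>cot \<theta>\<close>, an integer.\<close>
  have "line_length \<theta> = 1 / sin \<theta>"
    unfolding line_length_def
  proof (rule Least_equality)
    show "1 / sin \<theta> > 0 \<and> (\<forall>i. ((1 / sin \<theta>) *\<^sub>R direction \<theta>) $ i \<in> \<int>)"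
      using s cot by (simp add: forall_2 direction_def cot_def)
    fix l assume l: "l > 0 \<and> (\<forall>i. (l *\<^sub>R direction \<theta>) $ i \<in> \<int>)"
    then have "l * sin \<theta> \<in> \<int>" by (simp add: forall_2 direction_def)
    then obtain k :: int where k: "l * sin \<theta> = of_int k" by (auto elim: Ints_cases)
    have "0 < l * sin \<theta>" using l s by simp
    then have "1 \<le> k" unfolding k by simp
    then have "1 \<le> l * sin \<theta>" unfolding k by simp
    then show "1 / sin \<theta> \<le> l" using s by (simp add: field_simps)
  qed
  then show ?thesis using s by (simp add: vec_eq_iff forall_2 direction_def cot_def)
qed

lemma line_config_eq:
  assumes "0 < \<theta>" "\<theta> < pi" and n: "cot \<theta> = of_int n"
  shows "line_config \<theta> N = (\<lambda>k. (real k / real N) *\<^sub>R lattice_point (n, 1))"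
proof
  fix k
  have "line_config \<theta> N k = (real k / real N) *\<^sub>R (line_length \<theta> *\<^sub>R direction \<theta>)"
    by (simp add: line_config_def)
  also have "line_length \<theta> *\<^sub>R direction \<theta> = lattice_point (n, 1)"
    using line_length_direction[of \<theta>] assms by (simp add: vec_eq_iff forall_2)
  finally show "line_config \<theta> N k = (real k / real N) *\<^sub>R lattice_point (n, 1)" .
qed

text \<open>Combines \<open>cos x \<ge> 1/2\<close> up to \<open>pi / 3\<close> with
  \<open>sin x \<le> x\<close>. It converts a lower bound on the winding number into a bound on the
  angle.\<close>

lemma cot_ge:
  assumes "0 < x" "x \<le> pi / 3" "x \<le> 1 / (2 * c)" "0 < c"
  shows "c \<le> cot x"
proof -
  have s: "0 < sin x" using assms by (intro sin_gt_zero) auto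
  have "cos (pi / 3) \<le> cos x" using assms by (intro cos_monotone_0_pi_le) auto
  then have "1 / 2 \<le> cos x" by (simp add: cos_60)
  moreover have "sin x \<le> 1 / (2 * c)" using sin_x_le_x[of x] assms by linarith
  then have "c * sin x \<le> 1 / 2" using assms by (simp add: field_simps)
  ultimately have "c * sin x \<le> cos x" by linarith
  then show ?thesis using s by (simp add: cot_def field_simps)
qed

text \<open>The sum runs over a full period and is therefore independent of \<open>j\<close>;
  comparing \<open>j = N\<close> with \<open>j = 0\<close>, oddness shows that it equals its own
  negative.\<close>

lemma sum_odd_periodic:
  fixes \<psi> :: "int \<Rightarrow> real^2"
  assumes per: "\<And>r. \<psi> (r + int N) = \<psi> r" and odd: "\<And>r. \<psi> (- r) = - \<psi> r"
  shows "(\<Sum>k\<in>{1..N}. \<psi> (int j - int k)) = 0"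
proof -
  define T where "T = (\<lambda>j::nat. \<Sum>k\<in>{1..N}. \<psi> (int j - int k))"
  have tel: "(\<Sum>k\<in>{1..M}. \<psi> (int j + 1 - int k)) - (\<Sum>k\<in>{1..M}. \<psi> (int j - int k))
      = \<psi> (int j) - \<psi> (int j - int M)" for j M
    by (induction M) (simp_all add: algebra_simps)
  have "T (Suc j) = T j" for j
    using tel[of j N] per[of "int j - int N"] by (simp add: T_def add.commute)
  then have T: "T j = T 0" for j by (induction j) auto
  have \<psi>0: "\<psi> 0 = 0"
    using odd[of 0] by (simp add: vec_eq_iff)
  \<comment> \<open>The substitution gives the range from 0 to \<open>N - 1\<close>. It may be
    traded for the range from 1 to \<open>N\<close> because the values at 0 and \<open>N\<close>
    both vanish.\<close>
  have "T N = (\<Sum>k\<in>{1..N}. \<psi> (- (- int k)))"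
  proof -
    have "T N = (\<Sum>k\<in>{1..N}. \<psi> (int N - int k))" by (simp add: T_def)
    also have "\<dots> = (\<Sum>k\<in>{..<N}. \<psi> (int k))"
      by (rule sum.reindex_bij_witness[of _ "\<lambda>k. N - k" "\<lambda>k. N - k"]) auto
    also have "\<dots> = (\<Sum>k\<in>{..N}. \<psi> (int k)) - \<psi> (int N)"
      by (simp add: lessThan_Suc_atMost[symmetric])
    also have "\<dots> = (\<Sum>k\<in>{..N}. \<psi> (int k))" using per[of 0] \<psi>0 by simp
    also have "\<dots> = (\<Sum>k\<in>{1..N}. \<psi> (int k))"
      by (rule sum.mono_neutral_right) (auto simp: \<psi>0 not_le)
    finally show ?thesis by simp
  qed
  also have "\<dots> = (\<Sum>k\<in>{1..N}. - \<psi> (- int k))"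
    by (rule sum.cong[OF refl]) (rule odd)
  also have "\<dots> = - T 0" by (simp add: T_def sum_negf)
  finally have "T 0 = - T 0" using T[of N] by simp
  then have "T 0 = 0" by (simp add: vec_eq_iff)
  then show ?thesis using T[of j] by (simp add: T_def)
qed

lemma Re_exp_factor:
  "Re ((1 - exp (2 * of_real pi * \<i> * of_nat m * (of_nat k - of_nat j) / of_nat N)) * of_real r)
    = (1 - cos (2 * pi * real m * ((real k - real j) / real N))) * r"
proof -
  have "2 * of_real pi * \<i> * of_nat m * (of_nat k - of_nat j) / of_nat N
      = \<i> * complex_of_real (2 * pi * real m * ((real k - real j) / real N))"
    by simp
  then show ?thesis by (simp only: Re_exp) (simp add: Re_exp)
qed

lemma Re_exp_factor_continuum:
  "Re ((1 - exp (- 2 * of_real pi * \<i> * of_nat m * of_real s)) * of_real r)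
    = (1 - cos (2 * pi * real m * s)) * r"
proof -
  have "- 2 * of_real pi * \<i> * of_nat m * of_real s = \<i> * complex_of_real (- (2 * pi * real m * s))"
    by simp
  then show ?thesis by (simp only: Re_exp) (simp add: Re_exp)
qed

lemma Re_integral_nth:
  fixes F :: "real \<Rightarrow> complex^2"
  assumes "continuous_on {a..b} F"
  shows "Re (integral {a..b} F $ r) = integral {a..b} (\<lambda>s. Re (F s $ r))"
proof -
  have "bounded_linear (\<lambda>v::complex^2. Re (v $ r))"
    by (rule bounded_linear_compose[OF bounded_linear_Re bounded_linear_vec_nth])
  from integral_linear[OF integrable_continuous_real[OF assms] this] show ?thesis
    by (simp add: o_def)
qed

context cutoff_force
begin

text \<open>The force as a function of the index difference is odd, and it has period
  \<open>N\<close> because \<open>N\<close> steps add the lattice point \<open>p\<close>.\<close>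

lemma steady_state_line:
  "steady_state fl fs N (\<lambda>k. (real k / real N) *\<^sub>R lattice_point p)"
  unfolding steady_state_def
proof
  fix j assume j: "j \<in> {1..N}"
  then have N: "real N \<noteq> 0" by simp
  define \<psi> where "\<psi> = (\<lambda>r::int. periodic_force fl fs ((of_int r / real N) *\<^sub>R lattice_point p))"
  have per: "\<psi> (r + int N) = \<psi> r" for r
  proof -
    have "(of_int (r + int N) / real N) *\<^sub>R lattice_point p
        = (of_int r / real N) *\<^sub>R lattice_point p + lattice_point p"
      using N by (simp add: add_divide_distrib scaleR_add_left)
    then show ?thesis by (simp only: \<psi>_def periodic_force_add_lattice_point)
  qed
  have odd: "\<psi> (- r) = - \<psi> r" for r
    using periodic_force_minus[of "(of_int r / real N) *\<^sub>R lattice_point p"] by (simp add: \<psi>_def)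
  have "\<psi> 0 = 0" using odd[of 0] by (simp add: vec_eq_iff)
  then have "(\<Sum>k\<in>{1..N} - {j}. \<psi> (int j - int k)) = (\<Sum>k\<in>{1..N}. \<psi> (int j - int k))"
    by (intro sum.mono_neutral_left) auto
  also have "\<dots> = 0" by (rule sum_odd_periodic) (rule per odd)+
  finally show "(\<Sum>k\<in>{1..N} - {j}. periodic_force fl fs
      ((real j / real N) *\<^sub>R lattice_point p - (real k / real N) *\<^sub>R lattice_point p)) = 0"
    by (simp add: \<psi>_def scaleR_diff_left[symmetric] diff_divide_distrib)
qed

text \<open>The particle with index \<open>N\<close> sits at a lattice point, so reversing the index
  turns the sum into a left Riemann sum along the line through the origin.\<close>

lemma Re_trace_stability_matrix:
  fixes n :: int
  assumes "N > 0"
  shows "Re (stability_matrix fl fs N (\<lambda>k. (real k / real N) *\<^sub>R lattice_point (n, 1)) N m $ 1 $ 1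
      + stability_matrix fl fs N (\<lambda>k. (real k / real N) *\<^sub>R lattice_point (n, 1)) N m $ 2 $ 2)
    = (\<Sum>i<N. (1 - cos (2 * pi * real m * (real i / real N))) *
        (partial11 (of_int n * (real i / real N)) (real i / real N) + partial22 (of_int n * (real i / real N)) (real i / real N))) / real N"
    (is "Re (?M $ 1 $ 1 + ?M $ 2 $ 2) = (\<Sum>i<N. ?f i) / real N")
proof -
  let ?t = "\<lambda>k. (real N - real k) / real N"
  have arg: "(real N / real N) *\<^sub>R lattice_point (n, 1) - (real k / real N) *\<^sub>R lattice_point (n, 1)
      = vector [of_int n * ?t k, ?t k]" for k
    by (simp add: vec_eq_iff forall_2 field_simps)
  let ?c = "\<lambda>k. (1 - exp (2 * of_real pi * \<i> * of_nat m * (of_nat k - of_nat N) / of_nat N)) :: complex"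
  have "?M $ 1 $ 1 + ?M $ 2 $ 2 = (1 / of_nat N) *
      (\<Sum>k\<in>{1..N} - {N}. ?c k * of_real (partial11 (of_int n * ?t k) (?t k) + partial22 (of_int n * ?t k) (?t k)))"
    unfolding stability_matrix_def matrix_of_columns_def arg partial11_def partial22_def complex_vec_def
      vec_lambda_beta vector_smult_component sum_component of_real_add distrib_left sum.distrib ..
  also have "\<dots> = (\<Sum>k\<in>{1..N} - {N}. ?c k * of_real (partial11 (of_int n * ?t k) (?t k) + partial22 (of_int n * ?t k) (?t k)))
      / of_real (real N)"
    by simp
  finally have "Re (?M $ 1 $ 1 + ?M $ 2 $ 2) =
      (\<Sum>k\<in>{1..N} - {N}. Re (?c k * of_real (partial11 (of_int n * ?t k) (?t k) + partial22 (of_int n * ?t k) (?t k)))) / real N"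
    by (simp only: Re_divide_of_real Re_sum)
  also have "(\<Sum>k\<in>{1..N} - {N}. Re (?c k * of_real (partial11 (of_int n * ?t k) (?t k) + partial22 (of_int n * ?t k) (?t k))))
      = (\<Sum>k\<in>{1..<N}. ?f (N - k))"
  proof (rule sum.cong)
    fix k assume "k \<in> {1..<N}"
    then have t: "?t k = real (N - k) / real N" by (simp add: of_nat_diff)
    have "real k - real N = - (real N - real k)" by simp
    then have "2 * pi * real m * ((real k - real N) / real N) = - (2 * pi * real m * ?t k)"
      by (simp only: minus_divide_left[symmetric] mult_minus_right)
    then have "cos (2 * pi * real m * ((real k - real N) / real N)) = cos (2 * pi * real m * ?t k)"
      by (simp only: cos_minus)
    then show "Re (?c k * of_real (partial11 (of_int n * ?t k) (?t k) + partial22 (of_int n * ?t k) (?t k))) = ?f (N - k)"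
      unfolding Re_exp_factor by (simp only: t)
  qed auto
  also have "\<dots> = (\<Sum>i\<in>{1..<N}. ?f i)"
    by (rule sum.reindex_bij_witness[of _ "\<lambda>k. N - k" "\<lambda>k. N - k"]) auto
  \<comment> \<open>The term \<open>i = 0\<close>, the excluded self-interaction, can be added
    because \<open>1 - cos 0 = 0\<close>.\<close>
  also have "\<dots> = (\<Sum>i<N. ?f i)"
    by (rule sum.mono_neutral_left) (auto simp: not_le)
  finally show ?thesis .
qed

lemma unstable_particles_line:
  fixes n :: int and k :: nat
  assumes "k \<ge> 1" "n \<noteq> 0"
    and pos: "0 < integral {0..1} (\<lambda>t. (1 - cos (2 * pi * real k * (of_int n * t))) *
        (partial11 (of_int n * t) t + partial22 (of_int n * t) t))"
  shows "\<exists>N0. \<forall>N\<ge>N0. unstable_particles fl fs N (\<lambda>k. (real k / real N) *\<^sub>R lattice_point (n, 1))"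
proof -
  \<comment> \<open>The line has first coordinate \<open>n * t\<close>, so mode \<open>k\<close> in
    that coordinate is mode \<open>k * \<bar>n\<bar>\<close> in the line parameter \<open>t\<close>.
    This \<open>m\<close> does not depend on \<open>N\<close>, hence is allowed once
    \<open>N \<ge> m + 1\<close>.\<close>
  define m where "m = k * nat \<bar>n\<bar>"
  have m: "m \<ge> 1" using assms by (simp add: m_def)
  have cos_m: "cos (2 * pi * real m * t) = cos (2 * pi * real k * (of_int n * t))" for t
  proof (cases "n \<ge> 0")
    case False
    then have "2 * pi * real m * t = - (2 * pi * real k * (of_int n * t))" by (simp add: m_def)
    then show ?thesis by (simp only: cos_minus)
  qed (simp add: m_def mult.assoc)
  let ?g = "\<lambda>t. (1 - cos (2 * pi * real m * t)) * (partial11 (of_int n * t) t + partial22 (of_int n * t) t)"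
  have "continuous_on {0..1} ?g" by (intro continuous_intros continuous_partial11_partial22)
  then have "(\<lambda>N. (\<Sum>i<N. ?g (real i / real N)) / real N) \<longlonglongrightarrow> integral {0..1} ?g"
    by (rule riemann_sum_tendsto_integral)
  moreover have "0 < integral {0..1} ?g" unfolding cos_m by (rule pos)
  ultimately have "\<forall>\<^sub>F N in sequentially. 0 < (\<Sum>i<N. ?g (real i / real N)) / real N"
    by (rule order_tendstoD)
  then obtain N1 where N1: "\<And>N. N \<ge> N1 \<Longrightarrow> 0 < (\<Sum>i<N. ?g (real i / real N)) / real N"
    unfolding eventually_sequentially by blast
  have "unstable_particles fl fs N (\<lambda>k. (real k / real N) *\<^sub>R lattice_point (n, 1))"
    if N: "N \<ge> max N1 (m + 1)" for N
  proof -
    have "0 < (\<Sum>i<N. ?g (real i / real N)) / real N" using N1 N by simp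
    then have "has_unstable_eigenvalue
        (stability_matrix fl fs N (\<lambda>k. (real k / real N) *\<^sub>R lattice_point (n, 1)) N m)"
      using N by (intro has_unstable_eigenvalue_if_trace_pos) (simp only: Re_trace_stability_matrix)
    moreover have "N \<in> {1..N}" "m \<in> {1..N - 1}" using N m by auto
    ultimately show ?thesis unfolding unstable_particles_def by blast
  qed
  then show ?thesis by blast
qed

section \<open>The continuum trace near the horizontal\<close>

definition continuum_trace :: "nat \<Rightarrow> real \<Rightarrow> real" where
  "continuum_trace m \<theta> = integral {0..Rc} (\<lambda>s. (1 - cos (2 * pi * real m * s)) *
     (partial11 (s * cos \<theta>) (s * sin \<theta>) + partial22 (s * cos \<theta>) (s * sin \<theta>)))"

lemma continuous_continuum_trace: "continuous_on UNIV (continuum_trace m)"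
proof -
  have "continuous_on (UNIV \<times> cbox 0 Rc) (\<lambda>(\<theta>, s). (1 - cos (2 * pi * real m * s)) *
     (partial11 (s * cos \<theta>) (s * sin \<theta>) + partial22 (s * cos \<theta>) (s * sin \<theta>)))"
    unfolding split_beta by (intro continuous_intros continuous_partial11_partial22)
  from integral_continuous_on_param[OF this] show ?thesis
    unfolding continuum_trace_def by simp
qed

lemma Re_trace_continuum_stability_matrix:
  "Re (continuum_stability_matrix Rc fl fs \<theta> m $ 1 $ 1 + continuum_stability_matrix Rc fl fs \<theta> m $ 2 $ 2)
    = 2 * continuum_trace m \<theta>"
proof -
  let ?F = "\<lambda>i s. (1 - exp (- 2 * of_real pi * \<i> * of_nat m * of_real s)) *s
         complex_vec (partial_force fl fs i (s *\<^sub>R direction \<theta>))"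
  have arg: "s *\<^sub>R direction \<theta> = vector [s * cos \<theta>, s * sin \<theta>]" for s
    by (simp add: vec_eq_iff forall_2 direction_def)
  have cont: "continuous_on {0..Rc} (?F i)" for i
    unfolding vector_scalar_mult_def complex_vec_def
    by (intro continuous_on_vec_lambda continuous_intros
        continuous_on_compose2[OF continuous_partial_force]) (auto intro!: continuous_intros)
  have "Re (continuum_stability_matrix Rc fl fs \<theta> m $ 1 $ 1 + continuum_stability_matrix Rc fl fs \<theta> m $ 2 $ 2)
    = 2 * (Re (integral {0..Rc} (?F 1) $ 1) + Re (integral {0..Rc} (?F 2) $ 2))"
    by (simp add: continuum_stability_matrix_def matrix_of_columns_def)
  also have "\<dots> = 2 * (integral {0..Rc} (\<lambda>s. Re (?F 1 s $ 1)) + integral {0..Rc} (\<lambda>s. Re (?F 2 s $ 2)))"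
    by (simp only: Re_integral_nth[OF cont])
  also have "(\<lambda>s. Re (?F 1 s $ 1)) = (\<lambda>s. (1 - cos (2 * pi * real m * s)) * partial11 (s * cos \<theta>) (s * sin \<theta>))"
    unfolding complex_vec_def vector_smult_component vec_lambda_beta Re_exp_factor_continuum arg partial11_def ..
  also have "(\<lambda>s. Re (?F 2 s $ 2)) = (\<lambda>s. (1 - cos (2 * pi * real m * s)) * partial22 (s * cos \<theta>) (s * sin \<theta>))"
    unfolding complex_vec_def vector_smult_component vec_lambda_beta Re_exp_factor_continuum arg partial22_def ..
  also have "integral {0..Rc} (\<lambda>s. (1 - cos (2 * pi * real m * s)) * partial11 (s * cos \<theta>) (s * sin \<theta>)) +
      integral {0..Rc} (\<lambda>s. (1 - cos (2 * pi * real m * s)) * partial22 (s * cos \<theta>) (s * sin \<theta>))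
      = continuum_trace m \<theta>"
    unfolding continuum_trace_def distrib_left
    by (rule integral_add[symmetric]) (intro integrable_continuous_real continuous_intros continuous_partial11_partial22)+
  finally show ?thesis .
qed

lemma integral_fs_pos:
  assumes "\<And>s. s \<ge> 0 \<Longrightarrow> fs s \<ge> 0" "fs 0 > 0"
  shows "0 < integral {0..Rc} fs"
proof -
  have cont: "continuous_on {0..Rc} fs"
    using continuous_on_subset[OF coef_cont[of 2], of "{0..Rc}"] by (simp add: coef_def)
  have "0 \<le> integral {0..Rc} fs"
    by (intro integral_nonneg integrable_continuous_real cont) (use assms in auto)
  moreover have "integral {0..Rc} fs \<noteq> 0"
    using integral_eq_0_iff[OF cont Rc_pos] assms Rc_pos by force
  ultimately show ?thesis by linarith
qed

text \<open>Along the horizontal \<open>partial11\<close> integrates to boundary values of the force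
  at 0 and at distance \<open>Rc\<close>, both zero, while \<open>partial22\<close> contributes the
  positive integral of \<open>fs\<close>. A frequency whose cosine integral is smaller than this
  total then exists.\<close>

lemma exists_continuum_trace_pos:
  assumes fs: "\<And>s. s \<ge> 0 \<Longrightarrow> fs s \<ge> 0" "fs 0 > 0" and \<theta>: "\<theta> = 0 \<or> \<theta> = pi"
  obtains m where "m \<ge> 1" "0 < continuum_trace m \<theta>"
proof -
  have s0: "sin \<theta> = 0" and c: "cos \<theta> = 1 \<or> cos \<theta> = - 1" using \<theta> by auto
  let ?w = "\<lambda>s. partial11 (s * cos \<theta>) 0 + partial22 (s * cos \<theta>) 0"
  have contA: "continuous_on S (\<lambda>s. partial11 (s * cos \<theta>) 0)" and contB: "continuous_on S (\<lambda>s. partial22 (s * cos \<theta>) 0)"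
    for S by (intro continuous_partial11_partial22 continuous_intros)+
  have "integral {0..Rc} (\<lambda>s. partial11 (s * cos \<theta>) 0) = 0"
    using c
  proof
    assume "cos \<theta> = 1"
    then show ?thesis
      using Rc_pos Rc_le by (simp add: integral_partial11 periodic_force_square_1 fl_cutoff)
  next
    assume "cos \<theta> = - 1"
    \<comment> \<open>At angle \<open>pi\<close> the segment points left, and reflection turns it
      into the interval from \<open>- Rc\<close> to 0.\<close>
    then have "integral {0..Rc} (\<lambda>s. partial11 (s * cos \<theta>) 0) = integral {- Rc..0} (\<lambda>s. partial11 s 0)"
      using Henstock_Kurzweil_Integration.integral_reflect_real[of 0 "- Rc" "\<lambda>s. partial11 s 0"] by simp
    then show ?thesis
      using Rc_pos Rc_le by (simp add: integral_partial11 periodic_force_square_1 fl_cutoff)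
  qed
  moreover have "integral {0..Rc} (\<lambda>s. partial22 (s * cos \<theta>) 0) = integral {0..Rc} fs"
    by (rule integral_cong) (use c Rc_le in \<open>auto simp: partial22_axis\<close>)
  ultimately have w: "0 < integral {0..Rc} ?w"
    using integral_fs_pos[OF fs]
    by (simp add: integral_add integrable_continuous_real contA contB)
  have contw: "continuous_on {0..Rc} ?w" by (intro continuous_intros contA contB)
  obtain m where m: "m \<ge> 1" "integral {0..Rc} (\<lambda>s. cos (2 * pi * real m * s) * ?w s) < integral {0..Rc} ?w"
    using exists_cos_integral_less[OF contw Rc_le w] by blast
  have "continuum_trace m \<theta> = integral {0..Rc} (\<lambda>s. ?w s - cos (2 * pi * real m * s) * ?w s)"
    by (simp add: continuum_trace_def s0 left_diff_distrib)
  also have "\<dots> = integral {0..Rc} ?w - integral {0..Rc} (\<lambda>s. cos (2 * pi * real m * s) * ?w s)"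
    by (intro integral_diff integrable_continuous_real continuous_intros contw)
  finally show ?thesis using m that by simp
qed

text \<open>For a fixed mode the trace is continuous in the angle, so positivity at
  \<open>\<theta>0\<close> spreads to a neighbourhood.\<close>

lemma unstable_continuum_near_horizontal:
  assumes fs: "\<And>s. s \<ge> 0 \<Longrightarrow> fs s \<ge> 0" "fs 0 > 0" and \<theta>0: "\<theta>0 = 0 \<or> \<theta>0 = pi"
  shows "\<exists>d>0. \<forall>\<theta>. \<bar>\<theta> - \<theta>0\<bar> < d \<longrightarrow> unstable_continuum Rc fl fs \<theta>"
proof -
  obtain m where m: "m \<ge> 1" "0 < continuum_trace m \<theta>0"
    using exists_continuum_trace_pos[OF fs \<theta>0] by blast
  have "isCont (continuum_trace m) \<theta>0"
    using continuous_continuum_trace by (simp add: continuous_on_eq_continuous_at)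
  then have "\<forall>\<^sub>F \<theta> in at \<theta>0. 0 < continuum_trace m \<theta>"
    using m(2) unfolding isCont_def by (rule order_tendstoD)
  then obtain d where d: "d > 0" "\<And>\<theta>. \<theta> \<noteq> \<theta>0 \<Longrightarrow> dist \<theta> \<theta>0 < d \<Longrightarrow> 0 < continuum_trace m \<theta>"
    unfolding eventually_at by blast
  have "unstable_continuum Rc fl fs \<theta>" if "\<bar>\<theta> - \<theta>0\<bar> < d" for \<theta>
  proof -
    have "0 < continuum_trace m \<theta>"
      using d(2)[of \<theta>] m(2) that by (cases "\<theta> = \<theta>0") (auto simp: dist_real_def)
    then have "has_unstable_eigenvalue (continuum_stability_matrix Rc fl fs \<theta> m)"
      by (intro has_unstable_eigenvalue_if_trace_pos)
        (subst Re_trace_continuum_stability_matrix, simp)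
    then show ?thesis using m(1) unfolding unstable_continuum_def by blast
  qed
  then show ?thesis using d(1) by blast
qed

end

section \<open>Choice of the threshold angle\<close>

theorem theorem3p9:
  fixes Rc :: real and fl fs :: "real \<Rightarrow> real"
  assumes "0 < Rc" and "Rc \<le> 1/2"
    and "force_coefficients Rc fl fs"
    and "integral {0..Rc} fl \<le> 0"
    and "fs Rc = 0"
  shows "\<exists>\<phi>. 0 < \<phi> \<and> \<phi> < pi/2 \<and>
    (\<forall>\<theta>\<in>admissible_angles. \<theta> \<in> {0<..<pi} - {\<phi>..pi - \<phi>} \<longrightarrow>
       (\<exists>N0. \<forall>N\<ge>N0. steady_state fl fs N (line_config \<theta> N) \<and>
                       unstable_particles fl fs N (line_config \<theta> N)) \<and>
       unstable_continuum Rc fl fs \<theta>)"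
proof -
  from assms(3) have C1: "C1_on_nonneg fl" "C1_on_nonneg fs"
    and cut: "\<And>s. s \<ge> Rc \<Longrightarrow> fl s = 0" "\<And>s. s \<ge> Rc \<Longrightarrow> fs s = 0"
    and fs: "\<And>s. s \<ge> 0 \<Longrightarrow> fs s \<ge> 0" "fs 0 > 0"
    and change: "\<exists>a. 0 < a \<and> a < Rc \<and>
      (\<forall>s. 0 < s \<and> s < a \<longrightarrow> fl s > 0) \<and> (\<forall>s. a < s \<and> s < Rc \<longrightarrow> fl s < 0)"
    by (simp_all add: force_coefficients_def)
  from C1(1) obtain fl' where fl': "continuous_on {0..} fl'"
    "\<And>s. s \<ge> 0 \<Longrightarrow> (fl has_real_derivative fl' s) (at s within {0..})"
    unfolding C1_on_nonneg_def by blast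
  from C1(2) obtain fs' where fs': "continuous_on {0..} fs'"
    "\<And>s. s \<ge> 0 \<Longrightarrow> (fs has_real_derivative fs' s) (at s within {0..})"
    unfolding C1_on_nonneg_def by blast
  from change obtain a where a: "0 < a" "a < Rc" and neg: "\<And>s. a < s \<Longrightarrow> s < Rc \<Longrightarrow> fl s < 0"
    by blast
  interpret cutoff_force Rc fl fs fl' fs'
    by unfold_locales (fact assms fl' fs' cut)+
  obtain k :: nat and n0 where k: "k \<ge> 1" "n0 > 0" and pos: "\<And>n::int. n0 \<le> \<bar>real_of_int n\<bar> \<Longrightarrow>
      0 < integral {0..1} (\<lambda>t. (1 - cos (2 * pi * real k * (of_int n * t))) *
        (partial11 (of_int n * t) t + partial22 (of_int n * t) t))"
    using line_integral_pos_if_small_angle[OF a neg assms(4)] by blast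
  obtain d where d: "d > 0" "\<And>\<theta>. \<bar>\<theta> - 0\<bar> < d \<Longrightarrow> unstable_continuum Rc fl fs \<theta>"
    using unstable_continuum_near_horizontal[OF fs, of 0] by blast
  obtain e where e: "e > 0" "\<And>\<theta>. \<bar>\<theta> - pi\<bar> < e \<Longrightarrow> unstable_continuum Rc fl fs \<theta>"
    using unstable_continuum_near_horizontal[OF fs, of pi] by blast
  \<comment> \<open>The bounds \<open>d\<close> and \<open>e\<close> give continuum instability near
    0 and \<open>pi\<close>; \<open>pi / 4\<close> leaves only admissible angles with integer
    cotangent; \<open>1 / (2 * n0)\<close> forces \<open>\<bar>cot \<theta>\<bar> \<ge> n0\<close>
    through \<open>cot_ge\<close>.\<close>
  define \<phi> where "\<phi> = min (min d e) (min (pi / 4) (1 / (2 * n0)))"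
  have \<phi>: "0 < \<phi>" "\<phi> \<le> d" "\<phi> \<le> e" "\<phi> \<le> pi / 4" "\<phi> \<le> 1 / (2 * n0)"
    using d e k by (auto simp: \<phi>_def)
  have "(\<exists>N0. \<forall>N\<ge>N0. steady_state fl fs N (line_config \<theta> N) \<and>
                       unstable_particles fl fs N (line_config \<theta> N)) \<and>
       unstable_continuum Rc fl fs \<theta>"
    if adm: "\<theta> \<in> admissible_angles" and \<theta>: "\<theta> \<in> {0<..<pi} - {\<phi>..pi - \<phi>}" for \<theta>
  proof -
    from \<theta> have \<theta>01: "0 < \<theta>" "\<theta> < pi" and near: "\<theta> < \<phi> \<or> pi - \<phi> < \<theta>" by auto
    have "\<theta> \<notin> {0, pi/4, pi/2, 3*pi/4}" "\<theta> \<notin> {pi/4<..<3*pi/4}"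
      using near \<theta>01 \<phi>(4) by auto
    then have "cot \<theta> \<in> \<int>" using adm unfolding admissible_angles_def by blast
    then obtain n :: int where n: "cot \<theta> = of_int n" by (auto elim: Ints_cases)
    \<comment> \<open>Angles near \<open>pi\<close> are reflected to \<open>pi - \<theta>\<close>,
      which only changes the sign of the cotangent.\<close>
    have n0: "n0 \<le> \<bar>of_int n\<bar>"
      using near
    proof
      assume "\<theta> < \<phi>"
      then have "n0 \<le> cot \<theta>" using \<theta>01 \<phi> k by (intro cot_ge) auto
      then show ?thesis by (simp add: n)
    next
      assume "pi - \<phi> < \<theta>"
      then have "n0 \<le> cot (pi - \<theta>)" using \<theta>01 \<phi> k by (intro cot_ge) auto
      moreover have "cot (pi - \<theta>) = - cot \<theta>" by (simp add: cot_def)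
      ultimately show ?thesis by (simp add: n)
    qed
    then have "n \<noteq> 0" using k by auto
    then obtain N0 where "\<forall>N\<ge>N0. unstable_particles fl fs N (line_config \<theta> N)"
      using unstable_particles_line[OF k(1) _ pos[OF n0]] unfolding line_config_eq[OF \<theta>01 n] by blast
    moreover have "steady_state fl fs N (line_config \<theta> N)" for N
      unfolding line_config_eq[OF \<theta>01 n] by (rule steady_state_line)
    moreover have "unstable_continuum Rc fl fs \<theta>"
      using near
    proof
      assume "\<theta> < \<phi>"
      then show ?thesis using \<theta>01 \<phi> by (intro d(2)) simp
    next
      assume "pi - \<phi> < \<theta>"
      then show ?thesis using \<theta>01 \<phi> by (intro e(2)) simp
    qed
    ultimately show ?thesis by blast
  qed
  moreover have "\<phi> < pi / 2" using \<phi>(4) pi_gt_zero by linarith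
  ultimately show ?thesis using \<phi>(1) by blast
qed

end
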